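(* For any integer $k\ge1$ and any 2-connected outerplanar graph $G$ with maximum degree $\Delta(G)\ge7$, we have $\mathit{ch}_k(G)\le\bigl\lfloor\frac{\Delta(G)-2}{k}\bigr\rfloor+3$.
   Context: All graphs are finite and simple. An outerplanar graph is a graph that can be drawn in the plane so that all vertices lie on the outer face. For an integer $k\ge1$, a $k$-frugal colouring of $G$ is a proper vertex colouring such that no colour appears more than $k$ times in the neighbourhood of any vertex. A $t$-list assignment $L$ assigns to each vertex $v$ a list $L(v)$ of $t$ integers; $\mathit{ch}_k(G)$ is the least $t$ such that for every $t$-list assignment $L$ there is a $k$-frugal colouring with each vertex $v$ coloured from $L(v)$. *)

theory Defs
  imports "HOL-Analysis.Analysis"
begin

definition simple_graph :: "'a set \<Rightarrow> 'a set set \<Rightarrow> bool" where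
  "simple_graph V E \<longleftrightarrow> finite V \<and> (\<forall>e\<in>E. e \<subseteq> V \<and> card e = 2)"

definition nbhd :: "'a set set \<Rightarrow> 'a \<Rightarrow> 'a set" where
  "nbhd E v = {u. {u, v} \<in> E \<and> u \<noteq> v}"

definition max_degree :: "'a set \<Rightarrow> 'a set set \<Rightarrow> nat" where
  "max_degree V E = Max ((\<lambda>v. card (nbhd E v)) ` V)"

definition graph_connected :: "'a set \<Rightarrow> 'a set set \<Rightarrow> bool" where
  "graph_connected V E \<longleftrightarrow> V \<noteq> {} \<and> (\<forall>u\<in>V. \<forall>v\<in>V. (u, v) \<in> {(x, y). {x, y} \<in> E}\<^sup>*)"

text \<open>An \<open>l\<close>-connected graph has more than \<open>l\<close> vertices and stays connected after deleting
  any set \<open>X\<close> of fewer than \<open>l\<close> vertices (together with all edges meeting \<open>X\<close>).\<close>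

definition vertex_connected :: "nat \<Rightarrow> 'a set \<Rightarrow> 'a set set \<Rightarrow> bool" where
  "vertex_connected l V E \<longleftrightarrow> card V > l \<and>
     (\<forall>X \<subseteq> V. card X < l \<longrightarrow> graph_connected (V - X) {e \<in> E. e \<inter> X = {}})"

text \<open>The plane is modelled by the type of complex numbers. In a drawing, \<open>pos\<close> places the
  vertices and \<open>\<gamma> e\<close> is the simple arc representing the edge \<open>e\<close>. An arc contains no vertices
  other than its two ends, and two arcs meet only in the images of common end vertices.\<close>

definition plane_drawing ::
    "'a set \<Rightarrow> 'a set set \<Rightarrow> ('a \<Rightarrow> complex) \<Rightarrow> ('a set \<Rightarrow> real \<Rightarrow> complex) \<Rightarrow> bool" where
  "plane_drawing V E pos \<gamma> \<longleftrightarrow>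
     inj_on pos V \<and>
     (\<forall>e\<in>E. arc (\<gamma> e) \<and> {pathstart (\<gamma> e), pathfinish (\<gamma> e)} = pos ` e \<and>
        path_image (\<gamma> e) \<inter> pos ` V = pos ` e) \<and>
     (\<forall>e\<in>E. \<forall>f\<in>E. e \<noteq> f \<longrightarrow> path_image (\<gamma> e) \<inter> path_image (\<gamma> f) = pos ` (e \<inter> f))"

definition drawing_set ::
    "'a set \<Rightarrow> 'a set set \<Rightarrow> ('a \<Rightarrow> complex) \<Rightarrow> ('a set \<Rightarrow> real \<Rightarrow> complex) \<Rightarrow> complex set" where
  "drawing_set V E pos \<gamma> = pos ` V \<union> (\<Union>e\<in>E. path_image (\<gamma> e))"

text \<open>The drawing of a finite graph is compact, so its complement has exactly one unbounded
  component, namely its \<^const>\<open>outside\<close>. This is the outer face, and a vertex lies on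
  it if it belongs to the boundary of the face.\<close>

definition outerplanar :: "'a set \<Rightarrow> 'a set set \<Rightarrow> bool" where
  "outerplanar V E \<longleftrightarrow>
     (\<exists>pos \<gamma>. plane_drawing V E pos \<gamma> \<and> pos ` V \<subseteq> frontier (outside (drawing_set V E pos \<gamma>)))"

definition frugal_colouring :: "nat \<Rightarrow> 'a set \<Rightarrow> 'a set set \<Rightarrow> ('a \<Rightarrow> int) \<Rightarrow> bool" where
  "frugal_colouring k V E c \<longleftrightarrow>
     (\<forall>u v. {u, v} \<in> E \<and> u \<noteq> v \<longrightarrow> c u \<noteq> c v) \<and>
     (\<forall>v\<in>V. \<forall>i. card {u \<in> nbhd E v. c u = i} \<le> k)"

definition list_assignment :: "nat \<Rightarrow> 'a set \<Rightarrow> ('a \<Rightarrow> int set) \<Rightarrow> bool" where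
  "list_assignment t V L \<longleftrightarrow> (\<forall>v\<in>V. finite (L v) \<and> card (L v) = t)"

definition frugal_choosable :: "nat \<Rightarrow> nat \<Rightarrow> 'a set \<Rightarrow> 'a set set \<Rightarrow> bool" where
  "frugal_choosable k t V E \<longleftrightarrow>
     (\<forall>L. list_assignment t V L \<longrightarrow> (\<exists>c. frugal_colouring k V E c \<and> (\<forall>v\<in>V. c v \<in> L v)))"

definition frugal_choice_number :: "nat \<Rightarrow> 'a set \<Rightarrow> 'a set set \<Rightarrow> nat" where
  "frugal_choice_number k V E = (LEAST t. frugal_choosable k t V E)"

text \<open>The minimum above is over a nonempty set: with lists of size \<open>card V\<close> all vertices
  can receive different colours.\<close>

lemma inj_list_choice:
  fixes L :: "'a \<Rightarrow> int set"
  assumes "finite W" and "\<And>v. v \<in> W \<Longrightarrow> finite (L v) \<and> card W \<le> card (L v)"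
  shows "\<exists>c. inj_on c W \<and> (\<forall>v\<in>W. c v \<in> L v)"
  using assms
proof (induction W rule: finite_induct)
  case empty
  then show ?case by simp
next
  case (insert x W)
  have "\<And>v. v \<in> W \<Longrightarrow> finite (L v) \<and> card W \<le> card (L v)"
    using insert.prems insert.hyps by fastforce
  then obtain c where c: "inj_on c W" "\<forall>v\<in>W. c v \<in> L v"
    using insert.IH by blast
  have "card (c ` W) < card (L x)"
    using insert.prems[of x] insert.hyps card_image_le[of W c] by simp
  then have "\<not> L x \<subseteq> c ` W"
    using insert.hyps card_mono[of "c ` W" "L x"] by auto
  then obtain a where a: "a \<in> L x" "a \<notin> c ` W" by blast
  have "inj_on (c(x := a)) (insert x W)"
    using c(1) a(2) insert.hyps by (auto simp: inj_on_def)
  moreover have "\<forall>v\<in>insert x W. (c(x := a)) v \<in> L v"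
    using c(2) a(1) by auto
  ultimately show ?case by blast
qed

lemma frugal_choosable_card:
  assumes G: "simple_graph V E" and "k \<ge> 1"
  shows "frugal_choosable k (card V) V E"
  unfolding frugal_choosable_def
proof (intro allI impI)
  fix L :: "'a \<Rightarrow> int set"
  assume "list_assignment (card V) V L"
  then obtain c where c: "inj_on c V" "\<forall>v\<in>V. c v \<in> L v"
    using inj_list_choice[of V L] G by (auto simp: simple_graph_def list_assignment_def)
  have sub: "nbhd E v \<subseteq> V" for v
    using G by (auto simp: simple_graph_def nbhd_def)
  have "card {u \<in> nbhd E v. c u = i} \<le> k" for v i
  proof -
    have "card {u \<in> nbhd E v. c u = i} \<le> Suc 0"
      using c(1) sub[of v] G
      by (subst card_le_Suc0_iff_eq)
        (auto simp: inj_on_def simple_graph_def intro: finite_subset)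
    then show ?thesis using \<open>k \<ge> 1\<close> by simp
  qed
  moreover have "c u \<noteq> c v" if "{u, v} \<in> E" "u \<noteq> v" for u v
    using that G c(1) by (auto simp: simple_graph_def inj_on_def)
  ultimately show "\<exists>c. frugal_colouring k V E c \<and> (\<forall>v\<in>V. c v \<in> L v)"
    using c(2) unfolding frugal_colouring_def by blast
qed

end

theory Submission
  imports Defs "HOL-Complex_Analysis.Complex_Analysis"
begin

text \<open>Topology enters through winding numbers only. In an outerplanar drawing no vertex lies inside a
  cycle, so every edge with an end off a cycle \<open>C\<close> avoids the inside of \<open>C\<close>. Hence another cycle
  that misses a vertex of \<open>C\<close> and has no further edges between vertices of \<open>C\<close> does not wind around
  the inside of \<open>C\<close>. The relations between the cycles of a theta graph and of a subdivided \<open>K\<^sub>4\<close>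
  then contradict the fact that \<open>C\<close> has winding number \<open>\<plusminus>1\<close> around its own inside. The former
  makes a longest cycle of a 2-connected graph Hamiltonian, the latter makes the chords of that cycle
  pairwise non-crossing.

  For the colouring, fix \<open>D \<ge> 7\<close> and induct on the number of vertices, for all such graphs of maximum
  degree at most \<open>D\<close>. A vertex \<open>u\<close> with exactly two neighbours \<open>x\<close>, \<open>y\<close> is removed and the edge \<open>xy\<close>
  is added. In colouring \<open>u\<close> one must avoid the colours of \<open>x\<close> and \<open>y\<close> and those that already appear
  \<open>k\<close> times around \<open>x\<close> or \<open>y\<close>. A suitable \<open>u\<close> exists near the leaves of the tree of bounded faces:
  measure chords by the height of the subtree they cut off. At the boundary of a subtree of height
  three there is a vertex \<open>c\<close> of degree at most 6 at an end of a chord \<open>cd\<close> of height two, below which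
  all degrees are at most 4; a case distinction on the leaf faces below \<open>cd\<close> gives \<open>u\<close>.\<close>

section \<open>Outerplanar drawings\<close>

fun ledges :: "'a list \<Rightarrow> 'a set set" where
  "ledges (x # y # zs) = insert {x, y} (ledges (y # zs))"
| "ledges _ = {}"

lemma ledges_append: "ledges (xs @ m # ys) = ledges (xs @ [m]) \<union> ledges (m # ys)"
  by (induction xs rule: ledges.induct) auto

lemma ledges_rev [simp]: "ledges (rev xs) = ledges xs"
proof (induction xs rule: ledges.induct)
  case (1 x y zs)
  have "ledges (rev (x # y # zs)) = ledges (rev zs @ y # [x])" by simp
  also have "\<dots> = ledges (rev (y # zs)) \<union> {{y, x}}" by (subst ledges_append) simp
  finally show ?case using 1 by (auto simp: insert_commute)
qed auto

lemma ledges_subset_set: "e \<in> ledges xs \<Longrightarrow> e \<subseteq> set xs"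
  by (induction xs rule: ledges.induct) auto

lemma ledges_not_subset:
  assumes "distinct xs" "e \<in> ledges xs" "set xs \<inter> S \<subseteq> {m}"
  shows "\<not> e \<subseteq> S"
  using assms by (induction xs rule: ledges.induct) auto

lemma connected_in_outside:
  assumes "connected T" "T \<inter> S = {}" "y \<in> T" "y \<in> outside S"
  shows "T \<subseteq> outside S"
proof
  fix z assume "z \<in> T"
  then have "connected_component (- S) y z" using assms unfolding connected_component_def by blast
  then show "z \<in> outside S" using assms(4) outside_same_component by blast
qed

lemma connected_in_inside:
  assumes "connected T" "T \<inter> S = {}" "y \<in> T" "y \<in> inside S"
  shows "T \<subseteq> inside S"
proof
  fix z assume "z \<in> T"
  then have "connected_component (- S) y z" using assms unfolding connected_component_def by blast
  then show "z \<in> inside S" using assms(4) inside_same_component by blast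
qed

locale outer_drawing =
  fixes V :: "'a set" and E :: "'a set set" and pos :: "'a \<Rightarrow> complex"
    and \<gamma> :: "'a set \<Rightarrow> real \<Rightarrow> complex"
  assumes simple: "simple_graph V E" and drawing: "plane_drawing V E pos \<gamma>"
    and outer: "pos ` V \<subseteq> frontier (outside (drawing_set V E pos \<gamma>))"
begin

lemma edgeD: "{x, y} \<in> E \<Longrightarrow> x \<in> V \<and> y \<in> V \<and> x \<noteq> y"
  using simple by (auto simp: simple_graph_def)

lemma pos_eq_iff: "x \<in> V \<Longrightarrow> y \<in> V \<Longrightarrow> pos x = pos y \<longleftrightarrow> x = y"
  using drawing by (auto simp: plane_drawing_def inj_on_def)

definition earc :: "'a \<Rightarrow> 'a \<Rightarrow> real \<Rightarrow> complex" where
  "earc x y = (if pathstart (\<gamma> {x, y}) = pos x then \<gamma> {x, y} else reversepath (\<gamma> {x, y}))"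

lemma
  assumes "{x, y} \<in> E"
  shows pathstart_earc: "pathstart (earc x y) = pos x"
    and pathfinish_earc: "pathfinish (earc x y) = pos y"
    and arc_earc: "arc (earc x y)"
    and path_image_earc: "path_image (earc x y) = path_image (\<gamma> {x, y})"
    and earc_commute: "earc y x = reversepath (earc x y)"
proof -
  have *: "{pathstart (\<gamma> {x, y}), pathfinish (\<gamma> {x, y})} = {pos x, pos y}" "arc (\<gamma> {x, y})"
    using assms drawing by (auto simp: plane_drawing_def)
  have "pos x \<noteq> pos y" using edgeD[OF assms] pos_eq_iff by blast
  then consider "pathstart (\<gamma> {x, y}) = pos x" "pathfinish (\<gamma> {x, y}) = pos y" "pos x \<noteq> pos y"
    | "pathstart (\<gamma> {x, y}) = pos y" "pathfinish (\<gamma> {x, y}) = pos x" "pos x \<noteq> pos y"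
    using *(1) by (metis doubleton_eq_iff)
  then show "pathstart (earc x y) = pos x" "pathfinish (earc x y) = pos y" "arc (earc x y)"
    "path_image (earc x y) = path_image (\<gamma> {x, y})" "earc y x = reversepath (earc x y)"
    using *(2) by (cases; simp add: earc_def insert_commute arc_reversepath)+
qed

lemma edge_image_Int:
  "e \<in> E \<Longrightarrow> f \<in> E \<Longrightarrow> e \<noteq> f \<Longrightarrow> path_image (\<gamma> e) \<inter> path_image (\<gamma> f) = pos ` (e \<inter> f)"
  using drawing by (auto simp: plane_drawing_def)

lemma edge_image_vertex: "e \<in> E \<Longrightarrow> v \<in> V \<Longrightarrow> pos v \<in> path_image (\<gamma> e) \<longleftrightarrow> v \<in> e"
proof -
  assume e: "e \<in> E" and v: "v \<in> V"
  have "path_image (\<gamma> e) \<inter> pos ` V = pos ` e" "e \<subseteq> V"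
    using e drawing simple by (auto simp: plane_drawing_def simple_graph_def)
  then have "pos v \<in> path_image (\<gamma> e) \<longleftrightarrow> pos v \<in> pos ` e" using v by blast
  also have "\<dots> \<longleftrightarrow> v \<in> e" using v \<open>e \<subseteq> V\<close> pos_eq_iff by blast
  finally show ?thesis .
qed

fun walk :: "'a list \<Rightarrow> real \<Rightarrow> complex" where
  "walk [x, y] = earc x y"
| "walk (x # y # z # zs) = earc x y +++ walk (y # z # zs)"
| "walk _ = undefined"

definition limage :: "'a list \<Rightarrow> complex set" where
  "limage xs = (\<Union>e\<in>ledges xs. path_image (\<gamma> e))"

fun windsum :: "complex \<Rightarrow> 'a list \<Rightarrow> complex" where
  "windsum p (x # y # zs) = winding_number (earc x y) p + windsum p (y # zs)"
| "windsum p _ = 0"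

lemma windsum_append: "windsum p (xs @ m # ys) = windsum p (xs @ [m]) + windsum p (m # ys)"
  by (induction xs rule: ledges.induct) auto

lemma windsum_rev:
  assumes "ledges xs \<subseteq> E" "p \<notin> limage xs"
  shows "windsum p (rev xs) = - windsum p xs"
  using assms
proof (induction xs rule: ledges.induct)
  case (1 x y zs)
  have "windsum p (rev (x # y # zs)) = windsum p (rev zs @ y # [x])" by simp
  also have "\<dots> = windsum p (rev (y # zs)) + winding_number (earc y x) p"
    by (subst windsum_append) simp
  also have "winding_number (earc y x) p = - winding_number (earc x y) p"
    using 1 earc_commute[of x y] winding_number_reversepath[of "earc x y" p]
    by (simp add: limage_def path_image_earc arc_earc arc_imp_path)
  finally show ?case using 1 by (auto simp: limage_def)
qed auto

lemma walk_path:
  assumes "ledges xs \<subseteq> E" "length xs \<ge> 2"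
  shows "path (walk xs) \<and> pathstart (walk xs) = pos (hd xs) \<and> pathfinish (walk xs) = pos (last xs)
    \<and> path_image (walk xs) = limage xs \<and> (\<forall>p. p \<notin> limage xs \<longrightarrow> winding_number (walk xs) p = windsum p xs)"
  using assms
proof (induction xs rule: walk.induct)
  case (1 x y)
  then show ?case
    by (auto simp: limage_def pathstart_earc pathfinish_earc path_image_earc arc_earc arc_imp_path)
next
  case (2 x y z zs)
  have e: "{x, y} \<in> E" using 2 by auto
  have IH: "path (walk (y # z # zs))" "pathstart (walk (y # z # zs)) = pos y"
     "pathfinish (walk (y # z # zs)) = pos (last (y # z # zs))"
     "path_image (walk (y # z # zs)) = limage (y # z # zs)"
     "\<forall>p. p \<notin> limage (y # z # zs) \<longrightarrow> winding_number (walk (y # z # zs)) p = windsum p (y # z # zs)"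
    using 2 by auto
  have "winding_number (walk (x # y # z # zs)) p = windsum p (x # y # z # zs)"
    if "p \<notin> limage (x # y # z # zs)" for p
  proof -
    have "p \<notin> limage (y # z # zs)" "p \<notin> path_image (earc x y)" using that e
      by (auto simp: limage_def path_image_earc)
    then show ?thesis using IH e
      by (auto simp: winding_number_join arc_imp_path arc_earc pathfinish_earc)
  qed
  then show ?case using IH e
    by (auto simp: limage_def pathstart_earc pathfinish_earc path_image_earc arc_earc arc_imp_path path_image_join)
qed auto

lemma arc_walk:
  assumes "ledges xs \<subseteq> E" "length xs \<ge> 2" "distinct xs"
  shows "arc (walk xs)"
  using assms
proof (induction xs rule: walk.induct)
  case (2 x y z zs)
  have e: "{x, y} \<in> E" and es: "ledges (y # z # zs) \<subseteq> E" using 2 by auto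
  have "path_image (\<gamma> {x, y}) \<inter> path_image (\<gamma> f) \<subseteq> {pos y}" if "f \<in> ledges (y # z # zs)" for f
  proof -
    have "x \<notin> f" using ledges_subset_set[OF that] 2 by auto
    then have "{x, y} \<noteq> f" "{x, y} \<inter> f \<subseteq> {y}" by auto
    then show ?thesis using edge_image_Int[OF e] that es by blast
  qed
  then have "path_image (earc x y) \<inter> path_image (walk (y # z # zs)) \<subseteq> {pos y}"
    using walk_path[OF es] e by (auto simp: path_image_earc limage_def simp del: ledges.simps)
  then show ?case using 2 e walk_path[OF es]
    by (auto intro!: arc_join simp: arc_earc pathfinish_earc)
qed (auto simp: arc_earc)

lemma simple_path_walk:
  assumes "ledges (x # ys @ [x]) \<subseteq> E" "length ys \<ge> 2" "distinct (x # ys)"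
  shows "simple_path (walk (x # ys @ [x]))"
proof -
  obtain y z zs where ys: "ys = y # z # zs"
    using assms(2) by (metis Suc_le_length_iff numeral_2_eq_2)
  have e: "{x, y} \<in> E" and es: "ledges (ys @ [x]) \<subseteq> E" using assms(1) ys by auto
  have d: "distinct (ys @ [x])" using assms(3) by auto
  have "path_image (\<gamma> {x, y}) \<inter> path_image (\<gamma> f) \<subseteq> {pos x, pos y}" if "f \<in> ledges (ys @ [x])" for f
  proof -
    have "f = {y, z} \<or> f \<in> ledges (z # zs @ [x])" using that by (auto simp: ys)
    then have "{x, y} \<noteq> f" using ledges_subset_set[of f "z # zs @ [x]"] assms(3) ys
      by (auto simp: doubleton_eq_iff)
    then show ?thesis using edge_image_Int[OF e] that es by blast
  qed
  then have "path_image (earc x y) \<inter> path_image (walk (ys @ [x])) \<subseteq> {pos x, pos y}"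
    using walk_path[OF es] e assms(2) by (auto simp: path_image_earc limage_def simp del: ledges.simps)
  moreover have "arc (walk (ys @ [x]))" using arc_walk[OF es _ d] assms(2) by simp
  moreover have "pathstart (walk (ys @ [x])) = pos y" "pathfinish (walk (ys @ [x])) = pos x"
    using walk_path[OF es] assms(2) ys by auto
  ultimately have "simple_path (earc x y +++ walk (ys @ [x]))"
    using e by (intro simple_path_join_loop) (auto simp: arc_earc pathfinish_earc pathstart_earc)
  then show ?thesis by (simp add: ys)
qed

text \<open>Cycles are written as closed vertex lists, the first vertex being repeated at the end.\<close>

definition cycle :: "'a list \<Rightarrow> bool" where
  "cycle cs \<longleftrightarrow> ledges cs \<subseteq> E \<and> (\<exists>x ys. cs = x # ys @ [x] \<and> length ys \<ge> 2 \<and> distinct (x # ys))"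

lemma cycle_loop:
  assumes "cycle cs"
  shows "simple_path (walk cs)" "pathfinish (walk cs) = pathstart (walk cs)"
    "path_image (walk cs) = limage cs" "closed (limage cs)"
    "p \<notin> limage cs \<Longrightarrow> winding_number (walk cs) p = windsum p cs"
proof -
  obtain x ys where c: "cs = x # ys @ [x]" "ledges cs \<subseteq> E" "length ys \<ge> 2" "distinct (x # ys)"
    using assms by (auto simp: cycle_def)
  note w = walk_path[OF c(2)]
  show s: "simple_path (walk cs)" using c simple_path_walk by blast
  show "pathfinish (walk cs) = pathstart (walk cs)" using w c by auto
  show i: "path_image (walk cs) = limage cs" using w c by auto
  show "closed (limage cs)" using i s closed_simple_path_image by metis
  show "p \<notin> limage cs \<Longrightarrow> winding_number (walk cs) p = windsum p cs" using w c by auto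
qed

lemma cycle_ledges: "cycle cs \<Longrightarrow> ledges cs \<subseteq> E"
  by (auto simp: cycle_def)

lemma vertex_limage: "ledges xs \<subseteq> E \<Longrightarrow> length xs \<ge> 2 \<Longrightarrow> v \<in> V \<Longrightarrow> pos v \<in> limage xs \<longleftrightarrow> v \<in> set xs"
proof (induction xs rule: walk.induct)
  case (1 x y)
  then show ?case by (auto simp: limage_def edge_image_vertex)
next
  case (2 x y z zs)
  then show ?case by (fastforce simp: limage_def edge_image_vertex)
qed auto

lemma vertex_not_inside:
  assumes "cycle cs" "v \<in> V"
  shows "pos v \<notin> inside (limage cs)"
proof
  assume "pos v \<in> inside (limage cs)"
  moreover have "open (inside (limage cs))"
    using cycle_loop(4)[OF assms(1)] by (rule open_inside)
  moreover have "limage cs \<subseteq> drawing_set V E pos \<gamma>"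
    using cycle_ledges[OF assms(1)] by (auto simp: limage_def drawing_set_def)
  then have "inside (limage cs) \<inter> outside (drawing_set V E pos \<gamma>) = {}"
    using outside_mono inside_Int_outside[of "limage cs"] by blast
  ultimately have "pos v \<notin> closure (outside (drawing_set V E pos \<gamma>))"
    using open_Int_closure_eq_empty[of "inside (limage cs)"] by blast
  then show False using outer assms(2) by (auto simp: frontier_def)
qed

lemma set_subset_V: "ledges xs \<subseteq> E \<Longrightarrow> length xs \<ge> 2 \<Longrightarrow> set xs \<subseteq> V"
  by (induction xs rule: walk.induct) (auto dest: edgeD)

lemma edge_not_inside:
  assumes cs: "cycle cs" and e: "e \<in> E" and ne: "\<not> e \<subseteq> set cs"
  shows "path_image (\<gamma> e) \<inter> inside (limage cs) = {}"
proof -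
  obtain x y where xy: "e = {x, y}" "y \<notin> set cs" "{y, x} \<in> E"
  proof -
    obtain a b where ab: "e = {a, b}" using e simple by (auto simp: simple_graph_def card_2_iff)
    show thesis
    proof (cases "b \<in> set cs")
      case True
      then show thesis using that[of b a] ab ne e by (auto simp: insert_commute)
    next
      case False
      then show thesis using that[of a b] ab e by (auto simp: insert_commute)
    qed
  qed
  define g where "g = earc y x"
  define T where "T = (if x \<in> set cs then g ` {0..<1} else g ` {0..1})"
  have yV: "y \<in> V" "x \<in> V" using xy edgeD by auto
  have len: "ledges cs \<subseteq> E" "length cs \<ge> 2" using cs by (auto simp: cycle_def)
  have g: "path_image g = path_image (\<gamma> e)" "arc g" "g 0 = pos y" "g 1 = pos x"
    using xy path_image_earc[of y x] arc_earc[of y x] pathstart_earc[of y x] pathfinish_earc[of y x]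
    by (auto simp: g_def insert_commute pathstart_def pathfinish_def)
  have T0: "T \<subseteq> path_image g" "path_image g \<subseteq> insert (pos x) T"
  proof -
    show "T \<subseteq> path_image g" by (auto simp: T_def path_image_def)
    have "{0..1} = insert 1 {0..<1::real}" by auto
    then show "path_image g \<subseteq> insert (pos x) T" using g(4) by (auto simp: T_def path_image_def)
  qed
  have "continuous_on {0..1} g" using g(2) by (simp add: arc_def path_def)
  then have "connected T" unfolding T_def
    using connected_continuous_image[of "{0..1}" g] connected_continuous_image[of "{0..<1}" g]
      continuous_on_subset[of "{0..1}" g "{0..<1}"] by (auto simp: less_imp_le subset_iff)
  have "T \<inter> limage cs = {}"
  proof -
    have "path_image (\<gamma> e) \<inter> path_image (\<gamma> f) \<subseteq> {pos x} \<inter> pos ` set cs" if "f \<in> ledges cs" for f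
    proof -
      have "f \<subseteq> set cs" using that by (rule ledges_subset_set)
      then have "e \<noteq> f" "e \<inter> f \<subseteq> {x} \<inter> set cs" using xy by auto
      then show ?thesis using edge_image_Int[OF e] that len by blast
    qed
    then have sub: "path_image (\<gamma> e) \<inter> limage cs \<subseteq> {pos x} \<inter> pos ` set cs" by (auto simp: limage_def)
    show ?thesis
    proof (cases "x \<in> set cs")
      case True
      have "pos x \<notin> T"
      proof
        assume "pos x \<in> T"
        then obtain s where "0 \<le> s" "s < 1" "g s = g 1" using g(4) True by (auto simp: T_def)
        then show False using g(2) by (auto simp: arc_def dest: inj_onD[of g "{0..1}" s 1])
      qed
      then show ?thesis using sub T0 g(1) by auto
    next
      case False
      then have "pos x \<notin> limage cs" using vertex_limage[OF len yV(2)] by simp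
      then show ?thesis using sub T0 g(1) by auto
    qed
  qed
  moreover have "pos y \<in> T" using g(3) by (auto simp: T_def image_iff intro: bexI[of _ 0])
  moreover have "pos y \<in> outside (limage cs)"
    using vertex_not_inside[OF cs yV(1)] vertex_limage[OF len yV(1)] xy(2) inside_Un_outside[of "limage cs"] by blast
  ultimately have "T \<subseteq> outside (limage cs)"
    using \<open>connected T\<close> by (intro connected_in_outside) auto
  moreover have "pos x \<notin> inside (limage cs)" using vertex_not_inside[OF cs yV(2)] .
  ultimately show ?thesis using T0 g(1) inside_Int_outside[of "limage cs"] by blast
qed

text \<open>If \<open>p\<close> were inside \<open>ds\<close>, the whole inside of \<open>cs\<close> would be, and the vertex \<open>v\<close> on its boundary too.\<close>

lemma windsum_zero:
  assumes cs: "cycle cs" and ds: "cycle ds" and p: "p \<in> inside (limage cs)"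
    and v: "v \<in> set cs" "v \<notin> set ds"
    and e: "\<And>e. e \<in> ledges ds \<Longrightarrow> e \<in> ledges cs \<or> \<not> e \<subseteq> set cs"
  shows "windsum p ds = 0" "p \<notin> limage ds"
proof -
  let ?I = "inside (limage cs)" and ?J = "limage ds"
  have "path_image (\<gamma> f) \<inter> ?I = {}" if "f \<in> ledges ds" for f
  proof (cases "f \<in> ledges cs")
    case True
    then have "path_image (\<gamma> f) \<subseteq> limage cs" by (auto simp: limage_def)
    then show ?thesis using inside_no_overlap[of "limage cs"] by blast
  next
    case False
    then show ?thesis using edge_not_inside[OF cs] e[OF that] cycle_ledges[OF ds] that by blast
  qed
  then have disj: "?J \<inter> ?I = {}" by (auto simp: limage_def)
  then show pJ: "p \<notin> ?J" using p by auto
  have J: "connected ?I" "frontier ?I = limage cs"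
    using Jordan_inside_outside[OF cycle_loop(1,2)[OF cs]] cycle_loop(3)[OF cs] by simp_all
  have len: "ledges cs \<subseteq> E" "length cs \<ge> 2" "ledges ds \<subseteq> E" "length ds \<ge> 2"
    using cs ds by (auto simp: cycle_def)
  have vV: "v \<in> V" using v(1) set_subset_V[OF len(1,2)] by blast
  have "p \<in> outside ?J"
  proof (rule ccontr)
    assume "p \<notin> outside ?J"
    then have "p \<in> inside ?J" using pJ inside_Un_outside[of ?J] by blast
    then have "?I \<subseteq> inside ?J"
      using J(1) p disj by (intro connected_in_inside) auto
    then have "closure ?I \<subseteq> ?J \<union> inside ?J"
      using closure_inside_subset[OF cycle_loop(4)[OF ds]] closure_mono[OF \<open>?I \<subseteq> inside ?J\<close>] by blast
    moreover have "pos v \<in> closure ?I"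
      using J(2) vertex_limage[OF len(1,2) vV] v(1) by (auto simp: frontier_def)
    moreover have "pos v \<notin> ?J" using vertex_limage[OF len(3,4) vV] v(2) by simp
    ultimately show False using vertex_not_inside[OF ds vV] by blast
  qed
  then have "winding_number (walk ds) p = 0"
    using winding_number_zero_in_outside cycle_loop[OF ds] simple_path_imp_path by metis
  then show "windsum p ds = 0" using cycle_loop(5)[OF ds pJ] by simp
qed

lemma windsum_nonzero:
  assumes cs: "cycle cs"
  obtains p where "p \<in> inside (limage cs)" "p \<notin> limage cs" "windsum p cs \<noteq> 0"
proof -
  obtain p where p: "p \<in> inside (limage cs)"
    using Jordan_inside_outside[OF cycle_loop(1,2)[OF cs]] cycle_loop(3)[OF cs] by auto
  then have "p \<notin> limage cs" using inside_no_overlap[of "limage cs"] by blast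
  moreover have "cmod (winding_number (walk cs) p) = 1"
    using simple_closed_path_norm_winding_number_inside cycle_loop(1-3)[OF cs] p by metis
  ultimately show ?thesis using cycle_loop(5)[OF cs] p that by fastforce
qed

lemma theta_impossible:
  assumes ne: "A \<noteq> []" "B \<noteq> []" "P \<noteq> []" and d: "distinct (x # z # A @ B @ P)"
    and e: "ledges (x # A @ [z]) \<subseteq> E" "ledges (x # B @ [z]) \<subseteq> E" "ledges (x # P @ [z]) \<subseteq> E"
  shows False
proof -
  define cyc where "cyc M N = x # M @ z # rev N @ [x]" for M N :: "'a list"
  have le: "ledges (cyc M N) = ledges (x # M @ [z]) \<union> ledges (x # N @ [z])" for M N
    using ledges_append[of "x # M" z "rev N @ [x]"] ledges_rev[of "x # N @ [z]"] by (simp add: cyc_def)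
  have ws: "windsum p (cyc M N) = windsum p (x # M @ [z]) - windsum p (x # N @ [z])"
    if "ledges (x # N @ [z]) \<subseteq> E" "p \<notin> limage (x # N @ [z])" for p M N
    using windsum_append[of p "x # M" z "rev N @ [x]"] windsum_rev[OF that] by (simp add: cyc_def)
  have cy: "cycle (cyc A B)" "cycle (cyc B P)" "cycle (cyc P A)"
    unfolding cycle_def using ne d e
    by (auto simp: le simp del: ledges.simps) (force simp: cyc_def neq_Nil_conv)+
  obtain p where p: "p \<in> inside (limage (cyc A B))" "p \<notin> limage (cyc A B)" "windsum p (cyc A B) \<noteq> 0"
    using windsum_nonzero[OF cy(1)] .
  have P: "\<not> f \<subseteq> set (cyc A B)" if "f \<in> ledges (x # P @ [z])" for f
  proof -
    obtain y P' where P': "P = y # P'" using ne(3) by (cases P) auto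
    from that have "f = {x, y} \<or> f \<in> ledges (P @ [z])" by (auto simp: P')
    then show ?thesis
    proof
      assume "f = {x, y}" then show ?thesis using d P' by (auto simp: cyc_def)
    next
      assume "f \<in> ledges (P @ [z])"
      then show ?thesis using d
        by (intro ledges_not_subset[of "P @ [z]" _ _ z]) (auto simp: cyc_def)
    qed
  qed
  have BP: "windsum p (cyc B P) = 0 \<and> p \<notin> limage (cyc B P)"
  proof -
    have "hd A \<in> set (cyc A B)" "hd A \<notin> set (cyc B P)"
      using ne(1) d by (cases A; auto simp: cyc_def)+
    moreover have "f \<in> ledges (cyc A B) \<or> \<not> f \<subseteq> set (cyc A B)" if "f \<in> ledges (cyc B P)" for f
      using that P unfolding le by blast
    ultimately show ?thesis using windsum_zero[OF cy(1,2) p(1)] by metis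
  qed
  have PA: "windsum p (cyc P A) = 0 \<and> p \<notin> limage (cyc P A)"
  proof -
    have "hd B \<in> set (cyc A B)" "hd B \<notin> set (cyc P A)"
      using ne(2) d by (cases B; auto simp: cyc_def)+
    moreover have "f \<in> ledges (cyc A B) \<or> \<not> f \<subseteq> set (cyc A B)" if "f \<in> ledges (cyc P A)" for f
      using that P unfolding le by blast
    ultimately show ?thesis using windsum_zero[OF cy(1,3) p(1)] by metis
  qed
  have "p \<notin> limage (x # B @ [z])" "p \<notin> limage (x # P @ [z])" "p \<notin> limage (x # A @ [z])"
    using p(2) BP PA le by (auto simp: limage_def simp del: ledges.simps)
  then show False using p(3) BP PA e by (simp add: ws)
qed

lemma crossing_impossible:
  assumes d: "distinct (a # A @ c # B @ b # C @ d # F)"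
    and e: "ledges (a # A @ [c]) \<subseteq> E" "ledges (c # B @ [b]) \<subseteq> E"
      "ledges (b # C @ [d]) \<subseteq> E" "ledges (d # F @ [a]) \<subseteq> E"
    and ab: "{a, b} \<in> E" and cd: "{c, d} \<in> E"
  shows False
proof -
  define cyc where "cyc u M v N w = u # M @ v # N @ [w, u]" for M N :: "'a list" and u v w
  have le: "ledges (cyc u M v N w) = ledges (u # M @ [v]) \<union> ledges (v # N @ [w]) \<union> {{w, u}}" for u M v N w
    using ledges_append[of "u # M" v "N @ [w, u]"] ledges_append[of "v # N" w "[u]"] by (auto simp: cyc_def)
  have ws: "windsum p (cyc u M v N w) = windsum p (u # M @ [v]) + windsum p (v # N @ [w]) + winding_number (earc w u) p"
    for u M v N w p
    using windsum_append[of p "u # M" v "N @ [w, u]"] windsum_append[of p "v # N" w "[u]"] by (simp add: cyc_def)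
  have cyI: "cycle (cyc u M v N w)"
    if "ledges (u # M @ [v]) \<subseteq> E" "ledges (v # N @ [w]) \<subseteq> E" "{w, u} \<in> E" "distinct (u # M @ v # N @ [w])"
    for u M v N w
    unfolding cycle_def le using that by (auto simp: cyc_def intro!: exI[of _ u] exI[of _ "M @ v # N @ [w]"])
  let ?D = "cyc a A c B b" and ?C = "cyc b C d F a" and ?B = "cyc d F a A c" and ?A = "cyc c B b C d"
  have e': "{b, a} \<in> E" "{d, c} \<in> E" using ab cd by (simp_all add: insert_commute)
  have cy: "cycle ?D" "cycle ?C" "cycle ?B" "cycle ?A"
    using d e ab cd e' by (auto intro!: cyI)
  obtain p where p: "p \<in> inside (limage ?D)" "p \<notin> limage ?D" "windsum p ?D \<noteq> 0"
    using windsum_nonzero[OF cy(1)] .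
  have bCd: "\<not> f \<subseteq> set ?D" if "f \<in> ledges (b # C @ [d])" for f
    by (rule ledges_not_subset[OF _ that, where m = b]) (use d in \<open>auto simp: cyc_def\<close>)
  have dFa: "\<not> f \<subseteq> set ?D" if "f \<in> ledges (d # F @ [a])" for f
    by (rule ledges_not_subset[OF _ that, where m = a]) (use d in \<open>auto simp: cyc_def\<close>)
  have dD: "d \<notin> set ?D" using d by (auto simp: cyc_def)
  have "windsum p ?C = 0" "p \<notin> limage ?C"
  proof -
    have *: "f \<in> ledges ?D \<or> \<not> f \<subseteq> set ?D" if "f \<in> ledges ?C" for f
      using that bCd dFa by (auto simp: le insert_commute simp del: ledges.simps)
    have "c \<in> set ?D" "c \<notin> set ?C" using d by (auto simp: cyc_def)
    then show "windsum p ?C = 0" "p \<notin> limage ?C" using windsum_zero[OF cy(1,2) p(1)] * by metis+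
  qed
  moreover have "windsum p ?B = 0" "p \<notin> limage ?B"
  proof -
    have *: "f \<in> ledges ?D \<or> \<not> f \<subseteq> set ?D" if "f \<in> ledges ?B" for f
      using that dFa dD by (auto simp: le simp del: ledges.simps)
    have "b \<in> set ?D" "b \<notin> set ?B" using d by (auto simp: cyc_def)
    then show "windsum p ?B = 0" "p \<notin> limage ?B" using windsum_zero[OF cy(1,3) p(1)] * by metis+
  qed
  moreover have "windsum p ?A = 0"
  proof -
    have *: "f \<in> ledges ?D \<or> \<not> f \<subseteq> set ?D" if "f \<in> ledges ?A" for f
      using that bCd dD by (auto simp: le simp del: ledges.simps)
    have "a \<in> set ?D" "a \<notin> set ?A" using d by (auto simp: cyc_def)
    then show "windsum p ?A = 0" using windsum_zero[OF cy(1,4) p(1)] * by metis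
  qed
  moreover have "winding_number (earc b a) p = - winding_number (earc a b) p"
    using \<open>p \<notin> limage ?C\<close> ab earc_commute[OF ab] winding_number_reversepath[of "earc a b" p]
    by (simp add: limage_def le path_image_earc arc_earc arc_imp_path)
  moreover have "winding_number (earc d c) p = - winding_number (earc c d) p"
    using \<open>p \<notin> limage ?B\<close> cd earc_commute[OF cd] winding_number_reversepath[of "earc c d" p]
    by (simp add: limage_def le path_image_earc arc_earc arc_imp_path)
  \<comment> \<open>Both pairs of triangles of the subdivided \<open>K\<^sub>4\<close> add up to the cycle without the two chords.\<close>
  moreover have "windsum p ?D = windsum p ?B + windsum p ?A - windsum p ?C"
    using calculation(6,7) by (simp add: ws)
  ultimately have "windsum p ?D = 0" by simp
  then show False using p(3) by simp
qed

end

section \<open>Extending a colouring to a vertex of degree two\<close>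

definition heavy :: "nat \<Rightarrow> ('a \<Rightarrow> int) \<Rightarrow> 'a set \<Rightarrow> int set" where
  "heavy k c S = {i. k \<le> card {v \<in> S. c v = i}}"

lemma heavy_card:
  assumes "finite S" "k \<ge> 1"
  shows "finite (heavy k c S)" "card (heavy k c S) \<le> card S div k"
proof -
  have "heavy k c S \<subseteq> c ` S"
  proof
    fix i assume "i \<in> heavy k c S"
    then have "card {v \<in> S. c v = i} \<noteq> 0" using assms(2) by (simp add: heavy_def)
    then have "{v \<in> S. c v = i} \<noteq> {}" by (metis card.empty)
    then show "i \<in> c ` S" by blast
  qed
  then show fin: "finite (heavy k c S)" using assms(1) finite_surj by blast
  have "k * card (heavy k c S) \<le> (\<Sum>i\<in>heavy k c S. card {v \<in> S. c v = i})"
    using sum_mono[of "heavy k c S" "\<lambda>_. k" "\<lambda>i. card {v \<in> S. c v = i}"]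
    by (simp add: heavy_def mult.commute)
  also have "\<dots> = card (\<Union>i\<in>heavy k c S. {v \<in> S. c v = i})"
    using fin assms(1) by (subst card_UN_disjoint) auto
  also have "\<dots> \<le> card S" using assms(1) by (intro card_mono) auto
  finally show "card (heavy k c S) \<le> card S div k"
    using assms(2) by (simp add: less_eq_div_iff_mult_less_eq mult.commute)
qed

lemma heavy_mono: "finite T \<Longrightarrow> S \<subseteq> T \<Longrightarrow> heavy k c S \<subseteq> heavy k c T"
  by (auto simp: heavy_def elim!: order_trans intro!: card_mono)

definition contract :: "'a set set \<Rightarrow> 'a \<Rightarrow> 'a \<Rightarrow> 'a \<Rightarrow> 'a set set" where
  "contract E u x y = insert {x, y} {e \<in> E. u \<notin> e}"

text \<open>The first alternative bounds the number of heavy colours directly. In the second, the clique has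
  no colour twice and so matters only for \<open>k = 1\<close>, where common neighbours count once.\<close>

definition sparse_ends :: "nat \<Rightarrow> 'a set set \<Rightarrow> 'a \<Rightarrow> 'a \<Rightarrow> 'a \<Rightarrow> bool" where
  "sparse_ends D E u x y \<longleftrightarrow>
     card (nbhd E x - {u, y}) + card (nbhd E y - {u, x}) \<le> 5 \<or>
     card ((nbhd E x - {u, y}) \<union> (nbhd E y - {u, x})) \<le> D - 2 \<and>
       (\<forall>v\<in>nbhd E y - {u, x}. \<forall>w\<in>nbhd E y - {u, x}. v \<noteq> w \<longrightarrow> {v, w} \<in> E)"

lemma simple_graph_nbhd:
  assumes "simple_graph V E"
  shows "nbhd E v \<subseteq> V" "finite (nbhd E v)" "w \<in> nbhd E v \<longleftrightarrow> {w, v} \<in> E" "w \<in> nbhd E v \<longleftrightarrow> v \<in> nbhd E w"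
proof -
  show *: "nbhd E v \<subseteq> V" using assms by (auto simp: simple_graph_def nbhd_def)
  then show "finite (nbhd E v)" using assms finite_subset by (auto simp: simple_graph_def)
  show "w \<in> nbhd E v \<longleftrightarrow> {w, v} \<in> E" using assms by (auto simp: simple_graph_def nbhd_def)
  show "w \<in> nbhd E v \<longleftrightarrow> v \<in> nbhd E w" by (auto simp: nbhd_def insert_commute)
qed

lemma extend_colouring:
  assumes G: "simple_graph V E" and u: "u \<in> V" "nbhd E u = {x, y}" "x \<noteq> y"
    and k: "k \<ge> 1" and D: "D \<ge> 7" and sparse: "sparse_ends D E u x y"
    and red: "frugal_choosable k ((D - 2) div k + 3) (V - {u}) (contract E u x y)"
  shows "frugal_choosable k ((D - 2) div k + 3) V E"
  unfolding frugal_choosable_def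
proof (intro allI impI)
  fix L :: "'a \<Rightarrow> int set"
  assume L: "list_assignment ((D - 2) div k + 3) V L"
  let ?E' = "contract E u x y"
  obtain c where c: "frugal_colouring k (V - {u}) ?E' c" "\<forall>v\<in>V - {u}. c v \<in> L v"
    using red L by (auto simp: frugal_choosable_def list_assignment_def)
  note nb = simple_graph_nbhd[OF G]
  define A where "A = nbhd E x - {u, y}"
  define B where "B = nbhd E y - {u, x}"
  have fin: "finite A" "finite B" using nb by (auto simp: A_def B_def)
  have proper: "c v \<noteq> c w" if "{v, w} \<in> E" "v \<noteq> u" "w \<noteq> u" for v w
  proof -
    have "v \<noteq> w" using that G by (auto simp: simple_graph_def)
    then show ?thesis using that c(1) by (auto simp: frugal_colouring_def contract_def)
  qed
  have cxy: "c x \<noteq> c y" using c(1) u by (auto simp: frugal_colouring_def contract_def)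
  have "card (heavy k c A \<union> heavy k c B) \<le> (D - 2) div k"
  proof (cases "card A + card B \<le> 5")
    case True
    have "card (heavy k c A \<union> heavy k c B) \<le> card (heavy k c A) + card (heavy k c B)"
      by (rule card_Un_le)
    also have "\<dots> \<le> card A div k + card B div k"
      using heavy_card(2)[OF fin(1) k, of c] heavy_card(2)[OF fin(2) k, of c] by linarith
    also have "\<dots> \<le> (card A + card B) div k"
      by (metis div_add1_eq le_add1)
    also have "\<dots> \<le> (D - 2) div k" using True D by (intro div_le_mono) auto
    finally show ?thesis .
  next
    case False
    then have AB: "card (A \<union> B) \<le> D - 2" and B: "\<forall>v\<in>B. \<forall>w\<in>B. v \<noteq> w \<longrightarrow> {v, w} \<in> E"
      using sparse unfolding sparse_ends_def A_def[symmetric] B_def[symmetric] by auto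
    show ?thesis
    proof (cases "k = 1")
      case True
      have "heavy k c A \<union> heavy k c B \<subseteq> heavy k c (A \<union> B)"
        using heavy_mono[of "A \<union> B"] fin by simp
      then have "card (heavy k c A \<union> heavy k c B) \<le> card (heavy k c (A \<union> B))"
        using heavy_card(1)[of "A \<union> B" k c] fin k by (intro card_mono) auto
      also have "\<dots> \<le> card (A \<union> B) div k" using heavy_card(2)[of "A \<union> B" k c] fin k by simp
      also have "\<dots> \<le> (D - 2) div k" using AB by (rule div_le_mono)
      finally show ?thesis .
    next
      case False
      have "card {v \<in> B. c v = i} \<le> Suc 0" for i
      proof -
        have "v = w" if "v \<in> B" "w \<in> B" "c v = c w" for v w
          using that B proper[of v w] unfolding B_def by blast
        then show ?thesis using fin by (subst card_le_Suc0_iff_eq) auto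
      qed
      then have "heavy k c B = {}" using False k
        by (auto simp: heavy_def) (meson le_trans le_antisym One_nat_def)
      moreover have "card (heavy k c A) \<le> card A div k" using heavy_card(2) fin k by blast
      moreover have "card A \<le> D - 2" using AB card_mono[of "A \<union> B" A] fin by simp
      ultimately show ?thesis using div_le_mono[of "card A" "D - 2" k] by simp
    qed
  qed
  moreover have "card {c x, c y} \<le> 2" by (simp add: card_insert_if)
  ultimately have "card ({c x, c y} \<union> (heavy k c A \<union> heavy k c B)) \<le> (D - 2) div k + 2"
    using card_Un_le[of "{c x, c y}" "heavy k c A \<union> heavy k c B"] by linarith
  then have "card ({c x, c y} \<union> (heavy k c A \<union> heavy k c B)) < card (L u)"
    using L u by (simp add: list_assignment_def)
  then have "\<not> L u \<subseteq> {c x, c y} \<union> (heavy k c A \<union> heavy k c B)"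
    using heavy_card(1)[OF fin(1) k] heavy_card(1)[OF fin(2) k]
    by (meson card_mono finite.emptyI finite.insertI finite_UnI not_le)
  then obtain a where a: "a \<in> L u" "a \<noteq> c x" "a \<noteq> c y" "a \<notin> heavy k c A" "a \<notin> heavy k c B"
    by auto
  let ?c = "c(u := a)"
  have xy: "x \<noteq> u" "y \<noteq> u" "x \<in> V" "y \<in> V"
  proof -
    have "u \<notin> nbhd E u" by (simp add: nbhd_def)
    then show "x \<noteq> u" "y \<noteq> u" "x \<in> V" "y \<in> V" using u(2) nb(1)[of u] by auto
  qed
  have "?c v \<noteq> ?c w" if "{v, w} \<in> E" "v \<noteq> w" for v w
  proof -
    have "v \<in> nbhd E w" "w \<in> nbhd E v"
      using that(1) nb(3)[of v w] nb(4)[of w v] by blast+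
    then consider "v = u" "w \<in> nbhd E u" | "w = u" "v \<in> nbhd E u" | "v \<noteq> u" "w \<noteq> u"
      by blast
    then show ?thesis
    proof cases
      case 1
      then show ?thesis using that(2) u(2) a(2,3) by auto
    next
      case 2
      then show ?thesis using that(2) u(2) a(2,3) by auto
    next
      case 3
      then show ?thesis using proper[OF that(1)] by simp
    qed
  qed
  then have edge_ok: "\<forall>v w. {v, w} \<in> E \<and> v \<noteq> w \<longrightarrow> ?c v \<noteq> ?c w" by blast
  have end_ok: "card {w \<in> nbhd E v. ?c w = i} \<le> k"
    if v: "v \<in> V" "v \<noteq> u" "v \<noteq> v'" and nv: "nbhd E v \<subseteq> insert u (insert v' S)" "a \<noteq> c v'" "a \<notin> heavy k c S" "finite S"
      and sub: "nbhd E v - {u} \<subseteq> nbhd ?E' v" for v v' i S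
  proof (cases "i = a")
    case True
    have "{w \<in> nbhd E v. ?c w = a} \<subseteq> insert u {w \<in> S. c w = a}"
    proof
      fix w assume "w \<in> {w \<in> nbhd E v. ?c w = a}"
      then have "w \<in> insert u (insert v' S)" "w \<noteq> u \<Longrightarrow> c w = a" using nv(1) by auto
      then show "w \<in> insert u {w \<in> S. c w = a}" using nv(2) by auto
    qed
    then have "card {w \<in> nbhd E v. ?c w = a} \<le> card (insert u {w \<in> S. c w = a})"
      using nv(4) by (intro card_mono) auto
    also have "\<dots> \<le> Suc (card {w \<in> S. c w = a})"
      using nv(4) by (simp add: card_insert_if)
    finally show ?thesis using nv(3) True by (auto simp: heavy_def)
  next
    case False
    have "{w \<in> nbhd E v. ?c w = i} \<subseteq> {w \<in> nbhd ?E' v. c w = i}" using sub False by auto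
    moreover have "finite (nbhd ?E' v)"
    proof (rule finite_subset)
      show "nbhd ?E' v \<subseteq> insert x (insert y (nbhd E v))"
        by (auto simp: nbhd_def contract_def doubleton_eq_iff)
    qed (use nb(2) in simp)
    ultimately have "card {w \<in> nbhd E v. ?c w = i} \<le> card {w \<in> nbhd ?E' v. c w = i}"
      by (intro card_mono) auto
    also have "\<dots> \<le> k" using c(1) v by (simp add: frugal_colouring_def)
    finally show ?thesis .
  qed
  have "card {w \<in> nbhd E v. ?c w = i} \<le> k" if v: "v \<in> V" for v i
  proof -
    have sub: "nbhd E v - {u} \<subseteq> nbhd ?E' v" if "v \<noteq> u"
      using that by (auto simp: nbhd_def contract_def)
    consider "v = u" | "v = x" | "v = y" | "v \<notin> {u, x, y}" by auto
    then show ?thesis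
    proof cases
      case 1
      have "card {w \<in> nbhd E u. ?c w = i} \<le> Suc 0"
        using u xy cxy by (subst card_le_Suc0_iff_eq) auto
      then show ?thesis using 1 k by simp
    next
      case 2
      show ?thesis unfolding 2 by (rule end_ok[where v' = y and S = A]) (use a xy u sub fin 2 in \<open>auto simp: A_def\<close>)
    next
      case 3
      show ?thesis unfolding 3 by (rule end_ok[where v' = x and S = B]) (use a xy u sub fin 3 in \<open>auto simp: B_def\<close>)
    next
      case 4
      then have uv: "u \<notin> nbhd E v" using u(2) nb(4)[of u v] by auto
      then have "{w \<in> nbhd E v. ?c w = i} = {w \<in> nbhd E v. c w = i}" by auto
      moreover have "nbhd E v = nbhd ?E' v"
        using uv 4 by (auto simp: nbhd_def contract_def doubleton_eq_iff)
      ultimately show ?thesis using c(1) v 4 by (auto simp: frugal_colouring_def)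
    qed
  qed
  then have "frugal_colouring k V E ?c" using edge_ok unfolding frugal_colouring_def by blast
  moreover have "\<forall>v\<in>V. ?c v \<in> L v" using c(2) a(1) by auto
  ultimately show "\<exists>c. frugal_colouring k V E c \<and> (\<forall>v\<in>V. c v \<in> L v)" by blast
qed

section \<open>Non-crossing chords of a cycle\<close>

text \<open>\<open>level V E r a b\<close> says that the part of the graph cut off by the chord \<open>ab\<close> on the side of the
  vertices between \<open>a\<close> and \<open>b\<close> has at most \<open>r\<close> layers of bounded faces.\<close>

fun level :: "int set \<Rightarrow> int set set \<Rightarrow> nat \<Rightarrow> int \<Rightarrow> int \<Rightarrow> bool" where
  "level V E 0 a b \<longleftrightarrow> V \<inter> {a<..<b} = {}"
| "level V E (Suc r) a b \<longleftrightarrow>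
     (\<forall>c d. {c, d} \<in> E \<and> a \<le> c \<and> c < d \<and> d \<le> b \<and> (c, d) \<noteq> (a, b) \<longrightarrow> level V E r c d)"

definition reducible :: "nat \<Rightarrow> int set \<Rightarrow> int set set \<Rightarrow> int \<Rightarrow> bool" where
  "reducible D V E u \<longleftrightarrow> (\<exists>x y. u \<in> V \<and> nbhd E u = {x, y} \<and> (x < u \<and> u < y \<or> y < u \<and> u < x) \<and>
     sparse_ends D E u x y)"

locale outer_cycle =
  fixes V :: "int set" and E :: "int set set"
  assumes simple: "simple_graph V E"
    and consecutive: "a \<in> V \<Longrightarrow> b \<in> V \<Longrightarrow> a < b \<Longrightarrow> V \<inter> {a<..<b} = {} \<Longrightarrow> {a, b} \<in> E"
    and ends: "{Min V, Max V} \<in> E"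
    and noncrossing: "{a, b} \<in> E \<Longrightarrow> {c, d} \<in> E \<Longrightarrow> a < c \<Longrightarrow> c < b \<Longrightarrow> b < d \<Longrightarrow> False"
begin

abbreviation "lev \<equiv> level V E"
abbreviation "N \<equiv> nbhd E"

lemma fin: "finite V" and finN: "finite (N v)"
  using simple simple_graph_nbhd(2)[OF simple] by (simp_all add: simple_graph_def)

lemma edge_V: "{a, b} \<in> E \<Longrightarrow> a \<in> V \<and> b \<in> V"
  using simple by (auto simp: simple_graph_def)

lemma nb: "w \<in> N v \<longleftrightarrow> {v, w} \<in> E" "w \<in> N v \<longleftrightarrow> v \<in> N w" "v \<notin> N v"
  using simple_graph_nbhd(3)[OF simple, of w v] simple_graph_nbhd(4)[OF simple, of w v]
  by (simp_all add: insert_commute nbhd_def)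

lemma lev_SucD:
  "lev (Suc r) a b \<Longrightarrow> {c, d} \<in> E \<Longrightarrow> a \<le> c \<Longrightarrow> c < d \<Longrightarrow> d \<le> b \<Longrightarrow> (c, d) \<noteq> (a, b) \<Longrightarrow> lev r c d"
  by simp

lemma lev_subedge:
  assumes "lev r a b" "a \<le> c" "c < d" "d \<le> b"
  shows "lev r c d"
proof (cases r)
  case 0
  then show ?thesis using assms by fastforce
next
  case (Suc r')
  have "lev r' e f" if "{e, f} \<in> E" "c \<le> e" "e < f" "f \<le> d" "(e, f) \<noteq> (c, d)" for e f
  proof -
    have "(e, f) \<noteq> (a, b)" using that assms by auto
    then show ?thesis using assms that Suc by auto
  qed
  then show ?thesis using Suc by auto
qed

lemma right_degree:
  assumes "\<And>w. w \<in> R \<Longrightarrow> {a, w} \<in> E \<and> a < w \<and> lev r a w"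
  shows "card R \<le> Suc r"
  using assms
proof (induction r arbitrary: R)
  case 0
  have "finite R" using 0 edge_V fin by (meson finite_subset subsetI)
  moreover have "v = w" if "v \<in> R" "w \<in> R" for v w
    using 0[OF that(1)] 0[OF that(2)] edge_V[of a v] edge_V[of a w] by (cases v w rule: linorder_cases) auto
  ultimately show ?case by (simp add: card_le_Suc0_iff_eq)
next
  case (Suc r)
  have f: "finite R" using Suc.prems edge_V fin by (meson finite_subset subsetI)
  show ?case
  proof (cases "R = {}")
    case False
    let ?m = "Max R"
    have m: "?m \<in> R" using f False by simp
    have "{a, w} \<in> E \<and> a < w \<and> lev r a w" if "w \<in> R - {?m}" for w
    proof -
      have "w \<le> ?m" "w \<noteq> ?m" using that f by auto
      then show ?thesis using Suc.prems[OF m] Suc.prems[of w] that by auto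
    qed
    then have "card (R - {?m}) \<le> Suc r" by (rule Suc.IH)
    then show ?thesis using f m by simp
  qed simp
qed

lemma left_degree:
  assumes "\<And>w. w \<in> R \<Longrightarrow> {w, a} \<in> E \<and> w < a \<and> lev r w a"
  shows "card R \<le> Suc r"
  using assms
proof (induction r arbitrary: R)
  case 0
  have "finite R" using 0 edge_V fin by (meson finite_subset subsetI)
  moreover have "v = w" if "v \<in> R" "w \<in> R" for v w
    using 0[OF that(1)] 0[OF that(2)] edge_V[of v a] edge_V[of w a] by (cases v w rule: linorder_cases) auto
  ultimately show ?case by (simp add: card_le_Suc0_iff_eq)
next
  case (Suc r)
  have f: "finite R" using Suc.prems edge_V fin by (meson finite_subset subsetI)
  show ?case
  proof (cases "R = {}")
    case False
    let ?m = "Min R"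
    have m: "?m \<in> R" using f False by simp
    have "{w, a} \<in> E \<and> w < a \<and> lev r w a" if "w \<in> R - {?m}" for w
    proof -
      have "?m \<le> w" "w \<noteq> ?m" using that f by auto
      then show ?thesis using Suc.prems[OF m] Suc.prems[of w] that by auto
    qed
    then have "card (R - {?m}) \<le> Suc r" by (rule Suc.IH)
    then show ?thesis using f m by simp
  qed simp
qed

lemma nbhd_inside:
  assumes "{a, b} \<in> E" "a < v" "v < b" "w \<in> N v"
  shows "a \<le> w" "w \<le> b"
proof -
  have e: "{v, w} \<in> E" "{w, v} \<in> E" using assms(4) nb by (auto simp: insert_commute)
  show "a \<le> w" using noncrossing[OF e(2) assms(1)] assms(2,3) by force
  show "w \<le> b" using noncrossing[OF assms(1) e(1)] assms(2,3) by force
qed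

lemma successor:
  assumes "v \<in> V" "w \<in> V" "v < w"
  obtains s where "s \<in> V" "v < s" "s \<le> w" "V \<inter> {v<..<s} = {}" "{v, s} \<in> E"
proof -
  let ?S = "V \<inter> {v<..}" and ?s = "Min (V \<inter> {v<..})"
  have f: "finite ?S" "?S \<noteq> {}" using fin assms by auto
  have s: "?s \<in> V" "v < ?s" using Min_in[OF f] by auto
  have m: "?s \<le> x" if "x \<in> V" "v < x" for x using Min_le[OF f(1)] that by auto
  have e: "V \<inter> {v<..<?s} = {}" using m by fastforce
  show thesis using that[OF s m[OF assms(2,3)] e consecutive[OF assms(1) s e]] .
qed

lemma predecessor:
  assumes "v \<in> V" "w \<in> V" "w < v"
  obtains s where "s \<in> V" "s < v" "w \<le> s" "V \<inter> {s<..<v} = {}" "{v, s} \<in> E"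
proof -
  let ?S = "V \<inter> {..<v}" and ?s = "Max (V \<inter> {..<v})"
  have f: "finite ?S" "?S \<noteq> {}" using fin assms by auto
  have s: "?s \<in> V" "?s < v" using Max_in[OF f] by auto
  have m: "x \<le> ?s" if "x \<in> V" "x < v" for x using Max_ge[OF f(1)] that by auto
  have e: "V \<inter> {?s<..<v} = {}" using m by fastforce
  show thesis using that[OF s m[OF assms(2,3)] e] consecutive[OF s(1) assms(1) s(2) e]
    by (simp add: insert_commute)
qed

lemma adjacent_unique:
  assumes "V \<inter> {v<..<s} = {}" "V \<inter> {v<..<w} = {}" "s \<in> V" "w \<in> V" "v < s" "v < w"
  shows "w = s"
  using assms by (cases s w rule: linorder_cases) auto

lemma adjacent_unique_left:
  assumes "V \<inter> {s<..<v} = {}" "V \<inter> {w<..<v} = {}" "s \<in> V" "w \<in> V" "s < v" "w < v"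
  shows "w = s"
  using assms by (cases s w rule: linorder_cases) auto

lemma leaf_nbhd:
  assumes pq: "{p, q} \<in> E" "lev (Suc 0) p q" and v: "v \<in> V" "p < v" "v < q"
  obtains l r where "l \<in> V" "r \<in> V" "p \<le> l" "l < v" "v < r" "r \<le> q"
    "V \<inter> {l<..<v} = {}" "V \<inter> {v<..<r} = {}" "N v = {l, r}"
proof -
  have V: "p \<in> V" "q \<in> V" using edge_V[OF pq(1)] by auto
  obtain l where l: "l \<in> V" "l < v" "p \<le> l" "V \<inter> {l<..<v} = {}" "{v, l} \<in> E"
    using predecessor[OF v(1) V(1) v(2)] .
  obtain r where r: "r \<in> V" "v < r" "r \<le> q" "V \<inter> {v<..<r} = {}" "{v, r} \<in> E"
    using successor[OF v(1) V(2) v(3)] .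
  have "w = l \<or> w = r" if w: "w \<in> N v" for w
  proof -
    have b: "p \<le> w" "w \<le> q" using nbhd_inside[OF pq(1) v(2,3) w] by auto
    have e: "{v, w} \<in> E" "{w, v} \<in> E" "w \<in> V" using w nb(1) edge_V[of v w] by (auto simp: insert_commute)
    have "w \<noteq> v" using w nb(3) by auto
    then consider "w < v" | "v < w" by linarith
    then show ?thesis
    proof cases
      case 1
      then have "V \<inter> {w<..<v} = {}" using pq(2) e(2) b v by auto
      then show ?thesis using adjacent_unique_left[OF l(4) _ l(1) e(3) l(2) 1] by blast
    next
      case 2
      then have "V \<inter> {v<..<w} = {}" using pq(2) e(1) b v by auto
      then show ?thesis using adjacent_unique[OF r(4) _ r(1) e(3) r(2) 2] by blast
    qed
  qed
  then have "N v = {l, r}" using l(5) r(5) nb(1) by blast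
  then show thesis using that l r by blast
qed

lemma degree_split: "card (N v) \<le> card {w \<in> N v. w < v} + card {w \<in> N v. v < w}"
proof -
  have "N v = {w \<in> N v. w < v} \<union> {w \<in> N v. v < w}" using nb(3)[of v] by (auto simp: not_less le_less)
  then show ?thesis using card_Un_le by metis
qed

lemma inner_degree:
  assumes cd: "{c, d} \<in> E" "lev (Suc (Suc r)) c d" and v: "c < v" "v < d"
  shows "card {w \<in> N v. w < v} \<le> Suc (Suc r)" "card {w \<in> N v. v < w} \<le> Suc (Suc r)"
proof -
  show "card {w \<in> N v. w < v} \<le> Suc (Suc r)"
  proof (rule left_degree)
    fix w assume "w \<in> {w \<in> N v. w < v}"
    then have w: "w \<in> N v" "w < v" by auto
    have e: "{w, v} \<in> E" "c \<le> w"
      using nbhd_inside[OF cd(1) v w(1)] nb(1)[of w v] w(1) by (auto simp: insert_commute)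
    show "{w, v} \<in> E \<and> w < v \<and> lev (Suc r) w v"
      using lev_SucD[OF cd(2) e(1,2) w(2)] e(1) v w(2) by auto
  qed
  show "card {w \<in> N v. v < w} \<le> Suc (Suc r)"
  proof (rule right_degree)
    fix w assume "w \<in> {w \<in> N v. v < w}"
    then have w: "w \<in> N v" "v < w" by auto
    have e: "{v, w} \<in> E" "w \<le> d" using nbhd_inside[OF cd(1) v w(1)] nb(1)[of w v] w(1) by auto
    show "{v, w} \<in> E \<and> v < w \<and> lev (Suc r) v w"
      using lev_SucD[OF cd(2) e(1) _ w(2) e(2)] e(1) v w(2) by auto
  qed
qed

lemma inner_card:
  assumes cd: "{c, d} \<in> E" "lev (Suc (Suc 0)) c d" and v: "c < v" "v < d"
  shows "card (N v) \<le> 4"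
  using degree_split[of v] inner_degree[OF assms] by linarith

lemma card_minus2:
  assumes "a \<in> N v" "b \<in> N v" "a \<noteq> b"
  shows "card (N v - {a, b}) = card (N v) - 2"
  using assms by (subst card_Diff_subset) auto

lemma card_minus1:
  assumes "a \<in> N v"
  shows "card (N v - {a, b}) \<le> card (N v) - 1"
  using card_mono[of "N v - {a}" "N v - {a, b}"] finN assms by auto

lemma reducible_pair:
  assumes "u \<in> V" "N u = {p, v}" "p < u \<and> u < v \<or> v < u \<and> u < p" "N v = {u, w}" "card (N p) \<le> 5"
  shows "reducible D V E u"
proof -
  have "u \<in> N p" using assms(2) nb(2) by blast
  then have "card (N p - {u, v}) \<le> 4" using card_minus1[of u p v] assms(5) by linarith
  moreover have "N v - {u, p} \<subseteq> {w}" using assms(4) by auto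
  then have "card (N v - {u, p}) \<le> 1" using card_mono[of "{w}"] by force
  ultimately have "sparse_ends D E u p v" by (simp add: sparse_ends_def)
  then show ?thesis using assms(1-3) unfolding reducible_def by blast
qed

lemma long_leaf_reducible:
  assumes pq: "{p, q} \<in> E" "lev (Suc 0) p q" and v: "v \<in> V" "v' \<in> V" "p < v" "v < v'" "v' < q"
    and low: "card (N p) \<le> 5 \<or> card (N q) \<le> 5"
  shows "\<exists>u. reducible D V E u"
  using low
proof
  assume low: "card (N p) \<le> 5"
  have V: "p \<in> V" "q \<in> V" using edge_V[OF pq(1)] by auto
  obtain u where u: "u \<in> V" "p < u" "u \<le> v" "V \<inter> {p<..<u} = {}" "{p, u} \<in> E"
    using successor[OF V(1) v(1) v(3)] .
  obtain l r where lr: "l \<in> V" "r \<in> V" "p \<le> l" "l < u" "u < r" "V \<inter> {u<..<r} = {}" "N u = {l, r}"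
    using leaf_nbhd[OF pq u(1,2)] u(3) v by (metis order_le_less_trans less_trans)
  have lp: "l = p" using lr u(4) by (cases "l = p") auto
  have "r \<le> v'" using lr(5,6) v u(3) by (cases "r \<le> v'") auto
  then have rq: "p < r" "r < q" using lr u v by auto
  obtain l' r' where lr': "l' \<in> V" "l' < r" "V \<inter> {l'<..<r} = {}" "N r = {l', r'}"
    using leaf_nbhd[OF pq lr(2) rq] by metis
  have "l' = u" using adjacent_unique_left[OF lr(6) lr'(3) u(1) lr'(1) lr(5) lr'(2)] .
  then show ?thesis using reducible_pair[of u p r r'] u lr lp lr'(4) low by auto
next
  assume low: "card (N q) \<le> 5"
  have V: "p \<in> V" "q \<in> V" using edge_V[OF pq(1)] by auto
  obtain u where u: "u \<in> V" "u < q" "v' \<le> u" "V \<inter> {u<..<q} = {}" "{q, u} \<in> E"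
    using predecessor[OF V(2) v(2) v(5)] .
  have pu: "p < u" using u v by linarith
  obtain l r where lr: "l \<in> V" "r \<in> V" "l < u" "u < r" "r \<le> q" "V \<inter> {l<..<u} = {}" "N u = {l, r}"
    using leaf_nbhd[OF pq u(1) pu u(2)] by metis
  have rq: "r = q" using lr u(4) by (cases "r = q") auto
  have "v \<le> l" using lr(3,6) v u(3) by (cases "v \<le> l") auto
  then have lq: "p < l" "l < q" using lr u v by auto
  obtain l' r' where lr': "r' \<in> V" "l < r'" "V \<inter> {l<..<r'} = {}" "N l = {l', r'}"
    using leaf_nbhd[OF pq lr(1) lq] by metis
  have "r' = u" using adjacent_unique[OF lr(6) lr'(3) u(1) lr'(1) lr(3) lr'(2)] .
  then have "N l = {u, l'}" using lr'(4) by auto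
  then show ?thesis using reducible_pair[of u q l l'] u lr rq low by auto
qed

lemma pair_clique:
  assumes "S \<subseteq> {a, b}" "{a, b} \<in> E"
  shows "\<forall>v\<in>S. \<forall>w\<in>S. v \<noteq> w \<longrightarrow> {v, w} \<in> E"
proof (intro ballI impI)
  fix v w assume "v \<in> S" "w \<in> S" "v \<noteq> w"
  then have "{v, w} = {a, b}" using assms(1) by blast
  then show "{v, w} \<in> E" using assms(2) by simp
qed

lemma config_reducible:
  assumes cd: "{c, d} \<in> E" "c < d" "lev (Suc (Suc 0)) c d" "\<not> lev (Suc 0) c d"
    and right: "\<And>w. w \<in> N c \<Longrightarrow> w \<le> d" and left: "card {w \<in> N c. w < c} \<le> 3"
    and deg: "\<And>v. v \<in> V \<Longrightarrow> card (N v) \<le> D" and D: "D \<ge> 7"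
  shows "\<exists>u. reducible D V E u"
proof (rule ccontr)
  assume irred: "\<not> (\<exists>u. reducible D V E u)"
  define leaf where "leaf p q \<longleftrightarrow> {p, q} \<in> E \<and> c \<le> p \<and> p < q \<and> q \<le> d \<and> (p, q) \<noteq> (c, d) \<and> \<not> lev 0 p q" for p q
  have leaf_lev: "lev (Suc 0) p q" if "leaf p q" for p q
    using that lev_SucD[OF cd(3)] unfolding leaf_def by blast
  have leaf_low: "card (N p) \<le> 4 \<or> card (N q) \<le> 4" if "leaf p q" for p q
    using that inner_card[OF cd(1,3), of p] inner_card[OF cd(1,3), of q] unfolding leaf_def by fastforce
  have tri: "\<exists>u. u \<in> V \<and> p < u \<and> u < q \<and> V \<inter> {p<..<q} = {u} \<and> N u = {p, q}" if l: "leaf p q" for p q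
  proof -
    have pq: "{p, q} \<in> E" "lev (Suc 0) p q" using l leaf_lev[OF l] by (auto simp: leaf_def)
    obtain u where u: "u \<in> V" "p < u" "u < q" using l by (auto simp: leaf_def)
    have one: "w = u" if "w \<in> V" "p < w" "w < q" for w
    proof (rule ccontr)
      assume "w \<noteq> u"
      then consider "w < u" | "u < w" by linarith
      then have "\<exists>u. reducible D V E u"
      proof cases
        case 1
        then show ?thesis using long_leaf_reducible[OF pq that(1) u(1) that(2) 1 u(3)] leaf_low[OF l] by force
      next
        case 2
        then show ?thesis using long_leaf_reducible[OF pq u(1) that(1) u(2) 2 that(3)] leaf_low[OF l] by force
      qed
      then show False using irred by blast
    qed
    obtain l r where lr: "l \<in> V" "r \<in> V" "p \<le> l" "l < u" "u < r" "r \<le> q" "N u = {l, r}"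
      using leaf_nbhd[OF pq u] by metis
    have "l = p" "r = q" using one[OF lr(1)] one[OF lr(2)] lr u by force+
    moreover have "V \<inter> {p<..<q} = {u}"
    proof (rule set_eqI)
      show "w \<in> V \<inter> {p<..<q} \<longleftrightarrow> w \<in> {u}" for w using one[of w] u by (cases "w = u") auto
    qed
    ultimately show ?thesis using u lr(7) by blast
  qed
  have red: False if "u \<in> V" "N u = {x, y}" "x < u \<and> u < y \<or> y < u \<and> u < x" "sparse_ends D E u x y" for u x y
    using irred that unfolding reducible_def by blast
  have inner: False if l: "leaf p q" and pq: "c < p" "q < d" for p q
  proof -
    obtain u where u: "u \<in> V" "p < u" "u < q" "N u = {p, q}" using tri[OF l] by blast
    have e: "{p, q} \<in> E" "p < q" using l by (auto simp: leaf_def)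
    have "u \<in> N p" "u \<in> N q" "q \<in> N p" "p \<in> N q"
      using u(4) nb(2)[of u p] nb(2)[of u q] nb(1)[of q p] nb(2)[of p q] e by auto
    then have "card (N p - {u, q}) + card (N q - {u, p}) \<le> 5"
      using card_minus2[of u p q] card_minus2[of u q p] u inner_card[OF cd(1,3), of p] inner_card[OF cd(1,3), of q] pq e
      by simp
    then show False using red[OF u(1,4)] u by (simp add: sparse_ends_def)
  qed
  have rightc: "card {w \<in> N c. c < w} \<le> 3"
  proof -
    have "{c, w} \<in> E \<and> c < w \<and> lev (Suc (Suc 0)) c w" if "w \<in> {w \<in> N c. c < w}" for w
      using that nb(1)[of w c] right[of w] lev_subedge[OF cd(3), of c w] by auto
    then show ?thesis using right_degree[of "{w \<in> N c. c < w}" c "Suc (Suc 0)"] by simp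
  qed
  have dc: "d \<in> N c" using nb(1) cd(1) by blast
  have at_c: False if l: "leaf c q" for q
  proof -
    obtain u where u: "u \<in> V" "c < u" "u < q" "V \<inter> {c<..<q} = {u}" "N u = {c, q}" using tri[OF l] by blast
    have e: "{c, q} \<in> E" "c < q" "q < d" using l by (auto simp: leaf_def)
    have in_nb: "u \<in> N c" "u \<in> N q" "q \<in> N c" "c \<in> N q"
      using u(5) nb(2)[of u c] nb(2)[of u q] nb(1)[of q c] nb(2)[of c q] e by auto
    have A: "card (N c - {u, q}) \<le> 4"
      using card_minus2[OF in_nb(1,3)] u degree_split[of c] left rightc by linarith
    have "w \<in> {u, c}" if w: "w \<in> N q" "w < q" for w
    proof -
      have "c \<le> w" using nbhd_inside[OF cd(1) e(2,3) w(1)] by simp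
      have "w \<in> V" using edge_V[of q w] w nb(1) by blast
      show ?thesis
      proof (cases "w = c")
        case False
        then have "w \<in> V \<inter> {c<..<q}" using \<open>c \<le> w\<close> \<open>w \<in> V\<close> w by auto
        then show ?thesis using u(4) by auto
      qed simp
    qed
    then have Bsub: "N q - {u, c} \<subseteq> {w \<in> N q. q < w}"
      using nb(3)[of q] by (auto simp: not_less) (metis insertE linorder_less_linear singletonD)
    have B2: "card {w \<in> N q. q < w} \<le> 2" using inner_degree(2)[OF cd(1,3) e(2,3)] by simp
    have qV: "q \<in> V" "d \<in> V" using edge_V[OF e(1)] edge_V[OF cd(1)] by auto
    obtain s where s: "s \<in> V" "q < s" "s \<le> d" "V \<inter> {q<..<s} = {}" "{q, s} \<in> E"
      using successor[OF qV e(3)] .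
    show False
    proof (cases "{w \<in> N q. q < w} \<subseteq> {s}")
      case True
      then have "N q - {u, c} \<subseteq> {s}" using Bsub by blast
      then have "card (N q - {u, c}) \<le> 1" using card_mono[of "{s}"] by force
      then show False using A red[OF u(1,5)] u(2,3) by (simp add: sparse_ends_def)
    next
      case False
      then obtain r where r: "r \<in> N q" "q < r" "r \<noteq> s" by blast
      have rE: "{q, r} \<in> E" using r(1) nb(1) by blast
      have "r \<in> V" using edge_V[OF rE] by simp
      then have "s < r" using s(4) r by (cases s r rule: linorder_cases) auto
      have "r \<le> d" using nbhd_inside[OF cd(1) e(2,3) r(1)] by simp
      have lr: "leaf q r" using rE e(2) r \<open>s < r\<close> \<open>r \<le> d\<close> s(1,2) by (auto simp: leaf_def)
      have "r = d" using inner[OF lr e(2)] \<open>r \<le> d\<close> by fastforce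
      obtain s' where s': "V \<inter> {q<..<r} = {s'}" "N s' = {q, r}" using tri[OF lr] by blast
      have "s \<in> V \<inter> {q<..<r}" using s \<open>s < r\<close> by auto
      then have "N s = {q, d}" using s' \<open>r = d\<close> by auto
      then have sd: "{s, d} \<in> E" using nb(1) by blast
      have "{s, d} \<subseteq> {w \<in> N q. q < w}" using s r \<open>r = d\<close> nb(1) by blast
      moreover have "card {s, d} = 2" using r \<open>r = d\<close> by auto
      ultimately have "{w \<in> N q. q < w} = {s, d}"
        using B2 finN[of q] card_seteq[of "{w \<in> N q. q < w}" "{s, d}"] by auto
      then have B: "N q - {u, c} \<subseteq> {s, d}" using Bsub by simp
      have "d \<in> N c - {u, q}" using dc e u by auto
      then have "(N c - {u, q}) \<union> (N q - {u, c}) \<subseteq> insert s (N c - {u, q})" using B by auto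
      then have "card ((N c - {u, q}) \<union> (N q - {u, c})) \<le> card (insert s (N c - {u, q}))"
        using finN by (intro card_mono) auto
      also have "\<dots> \<le> 5" using A finN by (simp add: card_insert_if)
      finally have "card ((N c - {u, q}) \<union> (N q - {u, c})) \<le> D - 2" using D by simp
      moreover have "\<forall>v\<in>N q - {u, c}. \<forall>w\<in>N q - {u, c}. v \<noteq> w \<longrightarrow> {v, w} \<in> E"
        using B sd by (rule pair_clique)
      ultimately show False using red[OF u(1,5)] u(2,3) by (simp add: sparse_ends_def)
    qed
  qed
  have leaf_d: "c < p \<and> q = d" if l: "leaf p q" for p q
  proof -
    have "c < p" using at_c[of q] l by (cases "p = c") (auto simp: leaf_def)
    moreover have "q = d" using inner[OF l \<open>c < p\<close>] l by (cases "q = d") (auto simp: leaf_def)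
    ultimately show ?thesis ..
  qed
  obtain p q where "leaf p q" using cd(4) by (auto simp: leaf_def)
  then have lp: "leaf p d" and cp: "c < p" using leaf_d by blast+
  have unique: "p' = p \<and> q' = d" if l: "leaf p' q'" for p' q'
  proof -
    have q': "q' = d" using leaf_d[OF l] by simp
    have "\<not> p' < p"
    proof
      assume "p' < p"
      then show False using lev_SucD[OF leaf_lev[OF l], of p d] lp q' unfolding leaf_def by auto
    qed
    moreover have "\<not> p < p'"
    proof
      assume "p < p'"
      then show False using lev_SucD[OF leaf_lev[OF lp], of p' d] l q' unfolding leaf_def by auto
    qed
    ultimately show ?thesis using q' by simp
  qed
  have flat: "lev 0 x y" if "{x, y} \<in> E" "c \<le> x" "x < y" "y \<le> d" "(x, y) \<noteq> (c, d)" "(x, y) \<noteq> (p, d)" for x y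
    using unique[of x y] that unfolding leaf_def by blast
  have pd: "{p, d} \<in> E" "p < d" using lp by (auto simp: leaf_def)
  have V: "c \<in> V" "p \<in> V" "d \<in> V" using edge_V[OF cd(1)] edge_V[OF pd(1)] by auto
  obtain u where u: "u \<in> V" "p < u" "u < d" "V \<inter> {p<..<d} = {u}" "N u = {p, d}" using tri[OF lp] by blast
  have ud: "{u, d} \<in> E" using u(5) nb(1) by blast
  obtain l where l: "l \<in> V" "l < p" "c \<le> l" "V \<inter> {l<..<p} = {}" "{p, l} \<in> E"
    using predecessor[OF V(2,1) cp] .
  have Np: "N p = {l, u, d}"
  proof
    show "{l, u, d} \<subseteq> N p" using l(5) pd(1) nb(1) nb(2)[of u p] u(5) by auto
    show "N p \<subseteq> {l, u, d}"
    proof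
      fix w assume w: "w \<in> N p"
      have b: "c \<le> w" "w \<le> d" using nbhd_inside[OF cd(1) cp pd(2) w] by auto
      have e: "{p, w} \<in> E" "{w, p} \<in> E" using w nb(1) by (auto simp: insert_commute)
      have wV: "w \<in> V" using edge_V[OF e(1)] by simp
      have "w \<noteq> p" using w nb(3) by auto
      then consider "w < p" | "p < w" "w < d" | "w = d" using b(2) by linarith
      then show "w \<in> {l, u, d}"
      proof cases
        case 1
        then have "lev 0 w p" using flat[OF e(2) b(1) 1] pd by auto
        then show ?thesis using adjacent_unique_left[OF l(4) _ l(1) wV l(2) 1] by simp
      next
        case 2
        then have "w \<in> V \<inter> {p<..<d}" using wV by auto
        then show ?thesis using u(4) by auto
      qed simp
    qed
  qed
  show False
  proof (cases "l = c")
    case True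
    have in_nb: "u \<in> N d" "p \<in> N d" "c \<in> N d"
      using u(5) nb(2)[of u d] nb(2)[of p d] Np nb(2)[of d c] dc nb(2)[of d p] by auto
    have B: "N p - {u, d} \<subseteq> {c}" using Np True by auto
    have "(N d - {u, p}) \<union> (N p - {u, d}) = N d - {u, p}" using B in_nb(3) u cp cd(2) by auto
    then have "card ((N d - {u, p}) \<union> (N p - {u, d})) \<le> D - 2"
      using card_minus2[OF in_nb(1,2)] u deg[OF V(3)] by simp
    moreover have "\<forall>v\<in>N p - {u, d}. \<forall>w\<in>N p - {u, d}. v \<noteq> w \<longrightarrow> {v, w} \<in> E" using B by auto
    ultimately have "sparse_ends D E u d p" by (simp add: sparse_ends_def)
    moreover have "N u = {d, p}" using u(5) by auto
    ultimately show False using red[OF u(1)] u(2,3) by blast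
  next
    case False
    then have cl: "c < l" "l < d" using l pd by auto
    obtain m where m: "m \<in> V" "m < l" "c \<le> m" "V \<inter> {m<..<l} = {}" "{l, m} \<in> E"
      using predecessor[OF l(1) V(1) cl(1)] .
    have Nl: "N l = {m, p}"
    proof
      show "{m, p} \<subseteq> N l" using m(5) nb(1) nb(2)[of p l] Np nb(2)[of l p] by auto
      show "N l \<subseteq> {m, p}"
      proof
        fix w assume w: "w \<in> N l"
        have b: "c \<le> w" "w \<le> d" using nbhd_inside[OF cd(1) cl w] by auto
        have e: "{l, w} \<in> E" "{w, l} \<in> E" using w nb(1) by (auto simp: insert_commute)
        have wV: "w \<in> V" using edge_V[OF e(1)] by simp
        have "w \<noteq> l" using w nb(3) by auto
        then consider "w < l" | "l < w" by linarith
        then show "w \<in> {m, p}"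
        proof cases
          case 1
          then have "lev 0 w l" using flat[OF e(2) b(1) 1] cl by auto
          then show ?thesis using adjacent_unique_left[OF m(4) _ m(1) wV m(2) 1] by simp
        next
          case 2
          then have "lev 0 l w" using flat[OF e(1) _ 2 b(2)] cl l(2) by auto
          then show ?thesis using adjacent_unique[OF l(4) _ V(2) wV l(2) 2] by simp
        qed
      qed
    qed
    have B: "N p - {l, m} \<subseteq> {u, d}" using Np by auto
    have clique: "\<forall>v\<in>N p - {l, m}. \<forall>w\<in>N p - {l, m}. v \<noteq> w \<longrightarrow> {v, w} \<in> E"
      using B ud by (rule pair_clique)
    have lm: "l \<in> N m" using Nl nb(2)[of m l] by auto
    have "card ((N m - {l, p}) \<union> (N p - {l, m})) \<le> 5"
    proof (cases "m = c")
      case True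
      have "N c - {l, p} \<subseteq> {w \<in> N c. w < c} \<union> {d}"
      proof
        fix w assume w: "w \<in> N c - {l, p}"
        have e: "{c, w} \<in> E" using w nb(1) by auto
        have wV: "w \<in> V" using edge_V[OF e] by simp
        have "w \<noteq> c" using w nb(3) by auto
        then consider "w < c" | "w = d" | "c < w" "w \<noteq> d" by linarith
        then show "w \<in> {w \<in> N c. w < c} \<union> {d}"
        proof cases
          case 3
          then have "lev 0 c w" using flat[OF e _ 3(1)] right[of w] w cp by auto
          then have "w = l" using adjacent_unique[OF m(4) _ l(1) wV m(2)] True 3 by simp
          then show ?thesis using w by simp
        qed (use w in auto)
      qed
      then have "(N m - {l, p}) \<union> (N p - {l, m}) \<subseteq> {w \<in> N c. w < c} \<union> {d, u}" using B True by blast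
      then have "card ((N m - {l, p}) \<union> (N p - {l, m})) \<le> card ({w \<in> N c. w < c} \<union> {d, u})"
        using finN by (intro card_mono) auto
      also have "\<dots> \<le> card {w \<in> N c. w < c} + card {d, u}" by (rule card_Un_le)
      also have "card {d, u} \<le> 2" by (simp add: card_insert_if)
      finally show ?thesis using left by linarith
    next
      case False
      then have "c < m" "m < d" using m cl by auto
      then have "card (N m - {l, p}) \<le> 3" using card_minus1[OF lm, of p] inner_card[OF cd(1,3), of m] by linarith
      moreover have "card (N p - {l, m}) \<le> card {u, d}" using B by (intro card_mono) auto
      moreover have "card {u, d} \<le> 2" by (simp add: card_insert_if)
      ultimately show ?thesis using card_Un_le[of "N m - {l, p}" "N p - {l, m}"] by linarith
    qed
    then have "card ((N m - {l, p}) \<union> (N p - {l, m})) \<le> D - 2" using D by linarith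
    then have "sparse_ends D E l m p" using clique by (simp add: sparse_ends_def)
    then show False using red[OF l(1) Nl] l(2) m(2) by blast
  qed
qed

end

definition flip :: "int set set \<Rightarrow> int set set" where
  "flip E = (`) uminus ` E"

lemma flip_edge [simp]: "{a, b} \<in> flip E \<longleftrightarrow> {- a, - b} \<in> E"
proof
  assume "{a, b} \<in> flip E"
  then obtain e where e: "e \<in> E" "{a, b} = uminus ` e" by (auto simp: flip_def)
  have "e = uminus ` {a, b}" unfolding e(2) by (simp add: image_image)
  then show "{- a, - b} \<in> E" using e(1) by simp
next
  assume "{- a, - b} \<in> E"
  then have "uminus ` {- a, - b} \<in> flip E" unfolding flip_def by (rule imageI)
  then show "{a, b} \<in> flip E" by simp
qed

lemma nbhd_flip: "nbhd (flip E) v = uminus ` nbhd E (- v)"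
proof (rule set_eqI)
  fix w
  have "w \<in> uminus ` nbhd E (- v) \<longleftrightarrow> - w \<in> nbhd E (- v)" by force
  then show "w \<in> nbhd (flip E) v \<longleftrightarrow> w \<in> uminus ` nbhd E (- v)" by (simp add: nbhd_def)
qed

lemma level_flip: "level (uminus ` V) (flip E) r a b \<longleftrightarrow> level V E r (- b) (- a)"
proof (induction r arbitrary: a b)
  case 0
  have "uminus ` V \<inter> {a<..<b} = uminus ` (V \<inter> {- b<..<- a})" by force
  then show ?case by simp
next
  case (Suc r)
  show ?case
  proof
    assume h: "level (uminus ` V) (flip E) (Suc r) a b"
    have "level V E r c d" if "{c, d} \<in> E" "- b \<le> c" "c < d" "d \<le> - a" "(c, d) \<noteq> (- b, - a)" for c d
    proof -
      have "level (uminus ` V) (flip E) r (- d) (- c)"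
        using h that by (auto simp: insert_commute)
      then show ?thesis using Suc.IH[of "- d" "- c"] by simp
    qed
    then show "level V E (Suc r) (- b) (- a)" by simp
  next
    assume h: "level V E (Suc r) (- b) (- a)"
    have "level (uminus ` V) (flip E) r c d"
      if "{c, d} \<in> flip E" "a \<le> c" "c < d" "d \<le> b" "(c, d) \<noteq> (a, b)" for c d
    proof -
      have "level V E r (- d) (- c)"
        using h that by (auto simp: insert_commute)
      then show ?thesis using Suc.IH[of c d] by simp
    qed
    then show "level (uminus ` V) (flip E) (Suc r) a b" by simp
  qed
qed

lemma sparse_ends_flip: "sparse_ends D (flip E) u x y \<longleftrightarrow> sparse_ends D E (- u) (- x) (- y)"
proof -
  have d: "nbhd (flip E) a - {b, c} = uminus ` (nbhd E (- a) - {- b, - c})" for a b c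
    using image_set_diff[of uminus "nbhd E (- a)" "{- b, - c}"] by (simp add: nbhd_flip)
  have i: "card (uminus ` S) = card S" for S :: "int set" by (simp add: card_image)
  show ?thesis unfolding sparse_ends_def d i image_Un[symmetric] by simp
qed

lemma reducible_flip: "reducible D (uminus ` V) (flip E) u \<Longrightarrow> reducible D V E (- u)"
proof -
  assume "reducible D (uminus ` V) (flip E) u"
  then obtain x y where h: "u \<in> uminus ` V" "nbhd (flip E) u = {x, y}" "x < u \<and> u < y \<or> y < u \<and> u < x"
    "sparse_ends D (flip E) u x y" unfolding reducible_def by blast
  have "nbhd E (- u) = uminus ` nbhd (flip E) u" by (simp add: nbhd_flip image_image)
  then have "nbhd E (- u) = {- x, - y}" using h(2) by simp
  moreover have "- u \<in> V" using h(1) by force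
  ultimately show ?thesis using h(3,4) unfolding sparse_ends_flip reducible_def
    by (intro exI[of _ "- x"] exI[of _ "- y"]) auto
qed

context outer_cycle
begin

lemma outer_cycle_flip: "outer_cycle (uminus ` V) (flip E)"
proof
  have "card (uminus ` e) = 2 \<and> uminus ` e \<subseteq> uminus ` V" if "e \<in> E" for e
    using simple that by (auto simp: simple_graph_def card_image)
  then show "simple_graph (uminus ` V) (flip E)"
    using fin by (auto simp: simple_graph_def flip_def)
  show "{a, b} \<in> flip E" if h: "a \<in> uminus ` V" "b \<in> uminus ` V" "a < b" "uminus ` V \<inter> {a<..<b} = {}" for a b
  proof -
    have "V \<inter> {- b<..<- a} = {}"
    proof (rule ccontr)
      assume "V \<inter> {- b<..<- a} \<noteq> {}"
      then obtain x where "x \<in> V" "- b < x" "x < - a" by auto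
      then have "- x \<in> uminus ` V \<inter> {a<..<b}" by auto
      then show False using h(4) by blast
    qed
    then have "{- b, - a} \<in> E" using h by (intro consecutive) auto
    then show ?thesis by (simp add: insert_commute)
  qed
  have ne: "V \<noteq> {}" using ends edge_V by blast
  have "Min (uminus ` V) = - Max V" "Max (uminus ` V) = - Min V"
    using minus_Max_eq_Min[OF fin ne] minus_Min_eq_Max[OF fin ne] by simp_all
  then show "{Min (uminus ` V), Max (uminus ` V)} \<in> flip E" using ends by (simp add: insert_commute)
  show False if "{a, b} \<in> flip E" "{c, d} \<in> flip E" "a < c" "c < b" "b < d" for a b c d
    using noncrossing[of "- d" "- c" "- b" "- a"] that by (simp add: insert_commute)
qed

lemma Min_Max: "v \<in> V \<Longrightarrow> Min V \<le> v \<and> v \<le> Max V" "Min V \<in> V" "Max V \<in> V" "Min V < Max V"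
proof -
  show "v \<in> V \<Longrightarrow> Min V \<le> v \<and> v \<le> Max V" using fin by simp
  have *: "Min V \<in> V" "Max V \<in> V" using ends edge_V by auto
  then show "Min V \<in> V" "Max V \<in> V" by auto
  have "Min V \<noteq> Max V" using ends simple by (auto simp: simple_graph_def)
  then show "Min V < Max V" using * fin by (simp add: order_less_le)
qed

lemma ex_reducible:
  assumes card4: "card V \<ge> 4" and deg: "\<And>v. v \<in> V \<Longrightarrow> card (N v) \<le> D" and D: "D \<ge> 7"
  shows "\<exists>u. reducible D V E u"
proof (cases "\<forall>a b. {a, b} \<in> E \<and> a < b \<longrightarrow> lev 2 a b")
  case True
  then have lev2: "lev (Suc (Suc 0)) (Min V) (Max V)" using ends Min_Max(4) by (simp add: numeral_2_eq_2)
  have noleft: "{w \<in> N (Min V). w < Min V} = {}" using edge_V nb(1) Min_Max(1) by fastforce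
  show ?thesis
  proof (cases "lev (Suc 0) (Min V) (Max V)")
    case False
    have "w \<le> Max V" if "w \<in> N (Min V)" for w using edge_V[of "Min V" w] nb(1) that Min_Max(1) by blast
    then show ?thesis
      using config_reducible[OF ends Min_Max(4) lev2 False _ _ deg D] noleft by simp
  next
    case flat: True
    have "card (V - {Min V, Max V}) \<ge> 2"
      using card4 Min_Max fin by (subst card_Diff_subset) auto
    then obtain T where "T \<subseteq> V - {Min V, Max V}" "card T = 2"
      by (metis obtain_subset_with_card_n)
    then obtain a b where "a \<noteq> b" "{a, b} \<subseteq> V - {Min V, Max V}" by (auto simp: card_2_iff)
    then obtain v v' where v: "v \<in> V - {Min V, Max V}" "v' \<in> V - {Min V, Max V}" "v < v'"
      by (metis insert_subset linorder_neqE)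
    have "card {w \<in> N (Min V). Min V < w} \<le> 2"
    proof -
      have "{Min V, w} \<in> E \<and> Min V < w \<and> lev (Suc 0) (Min V) w" if "w \<in> {w \<in> N (Min V). Min V < w}" for w
      proof -
        have e: "{Min V, w} \<in> E" using that nb(1) by auto
        then have "w \<le> Max V" using edge_V[OF e] Min_Max(1) by blast
        then show ?thesis using lev_subedge[OF flat, of "Min V" w] e that by auto
      qed
      then show ?thesis using right_degree[of "{w \<in> N (Min V). Min V < w}" "Min V" "Suc 0"] by simp
    qed
    then have "card (N (Min V)) \<le> 5" using degree_split[of "Min V"] noleft by simp
    moreover have "Min V < v" "v' < Max V" using v Min_Max(1)[of v] Min_Max(1)[of v'] by auto
    ultimately show ?thesis
      using long_leaf_reducible[OF ends flat, of v v'] v by blast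
  qed
next
  case False
  note level.simps(2) [simp del]
  from False obtain a0 b0 where "{a0, b0} \<in> E \<and> a0 < b0 \<and> \<not> lev 2 a0 b0" by blast
  then obtain a b where ab: "{a, b} \<in> E" "a < b" "\<not> lev 2 a b"
    and min: "\<And>c d. {c, d} \<in> E \<and> c < d \<and> \<not> lev 2 c d \<Longrightarrow> nat (b - a) \<le> nat (d - c)"
    using ex_has_least_nat[of "\<lambda>(a, b). {a, b} \<in> E \<and> a < b \<and> \<not> lev 2 a b" "(a0, b0)" "\<lambda>(a, b). nat (b - a)"]
    by auto
  have sub2: "lev (Suc (Suc 0)) c d" if "{c, d} \<in> E" "a \<le> c" "c < d" "d \<le> b" "(c, d) \<noteq> (a, b)" for c d
  proof (rule ccontr)
    assume "\<not> lev (Suc (Suc 0)) c d"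
    then have "nat (b - a) \<le> nat (d - c)" using min[of c d] that by (simp add: numeral_2_eq_2)
    then show False using that by auto
  qed
  let ?P = "\<lambda>(c, d). {c, d} \<in> E \<and> a \<le> c \<and> c < d \<and> d \<le> b \<and> (c, d) \<noteq> (a, b) \<and> \<not> lev (Suc 0) c d"
  obtain c0 d0 where "?P (c0, d0)"
    using ab(3) unfolding numeral_2_eq_2 level.simps(2)[of V E "Suc 0"] by auto
  moreover have "\<forall>x. ?P x \<longrightarrow> (\<lambda>(c, d). nat (d - c)) x < Suc (nat (b - a))" by auto
  ultimately obtain c d where P: "?P (c, d)" and max: "\<And>x. ?P x \<Longrightarrow> (\<lambda>(c, d). nat (d - c)) x \<le> nat (d - c)"
    using ex_has_greatest_nat[of ?P "(c0, d0)" "\<lambda>(c, d). nat (d - c)" "Suc (nat (b - a))"] by auto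
  have cd: "{c, d} \<in> E" "a \<le> c" "c < d" "d \<le> b" "(c, d) \<noteq> (a, b)" "\<not> lev (Suc 0) c d" using P by auto
  have lev2: "lev (Suc (Suc 0)) c d" using sub2 cd by blast
  have maximal: "(e, f) = (c, d)" if "{e, f} \<in> E" "a \<le> e" "e \<le> c" "d \<le> f" "f \<le> b" "(e, f) \<noteq> (a, b)" for e f
  proof -
    have "\<not> lev (Suc 0) e f" using lev_subedge[of "Suc 0" e f c d] cd that by blast
    then have "nat (f - e) \<le> nat (d - c)" using max[of "(e, f)"] that cd by auto
    then show ?thesis using that cd by auto
  qed
  consider "a < c" | "c = a" "d < b" using cd by fastforce
  then show ?thesis
  proof cases
    case 1
    have c: "c < b" using cd by simp
    have "w \<le> d" if w: "w \<in> N c" for w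
    proof (rule ccontr)
      assume "\<not> w \<le> d"
      moreover have "{c, w} \<in> E" "w \<le> b" using w nb(1) nbhd_inside[OF ab(1) 1 c w] by auto
      ultimately show False using maximal[of c w] cd 1 by auto
    qed
    moreover have "card {w \<in> N c. w < c} \<le> 3"
    proof -
      have "{w, c} \<in> E \<and> w < c \<and> lev (Suc (Suc 0)) w c" if "w \<in> {w \<in> N c. w < c}" for w
      proof -
        have e: "{w, c} \<in> E" "a \<le> w" "w < c"
          using that nb(1)[of w c] nbhd_inside[OF ab(1) 1 c, of w] by (auto simp: insert_commute)
        then show ?thesis using sub2[OF e] c by auto
      qed
      then show ?thesis using left_degree[of "{w \<in> N c. w < c}" c "Suc (Suc 0)"] by simp
    qed
    ultimately show ?thesis using config_reducible[OF cd(1,3) lev2 cd(6) _ _ deg D] by blast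
  next
    case 2
    have d: "a < d" using cd by simp
    interpret flipped: outer_cycle "uminus ` V" "flip E" by (rule outer_cycle_flip)
    have right: "w \<le> - c" if "w \<in> nbhd (flip E) (- d)" for w
    proof (rule ccontr)
      assume "\<not> w \<le> - c"
      moreover have w: "- w \<in> N d" using that by (auto simp: nbhd_flip)
      moreover have "{- w, d} \<in> E" "a \<le> - w"
        using nb(1)[of "- w" d] w nbhd_inside[OF ab(1) d 2(2) w] by (auto simp: insert_commute)
      ultimately show False using 2 by auto
    qed
    have left: "card {w \<in> nbhd (flip E) (- d). w < - d} \<le> 3"
    proof -
      have "{w, - d} \<in> flip E \<and> w < - d \<and> level (uminus ` V) (flip E) (Suc (Suc 0)) w (- d)"
        if "w \<in> {w \<in> nbhd (flip E) (- d). w < - d}" for w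
      proof -
        have w: "- w \<in> N d" "d < - w" using that by (auto simp: nbhd_flip)
        have e: "{d, - w} \<in> E" "- w \<le> b"
          using w nb(1)[of "- w" d] nbhd_inside[OF ab(1) d 2(2) w(1)] by auto
        have "lev (Suc (Suc 0)) d (- w)" using sub2[OF e(1) _ w(2) e(2)] d by auto
        then show ?thesis unfolding level_flip using e w by (simp add: insert_commute)
      qed
      then show ?thesis
        using flipped.left_degree[of "{w \<in> nbhd (flip E) (- d). w < - d}" "- d" "Suc (Suc 0)"] by simp
    qed
    have e: "{- d, - c} \<in> flip E" "- d < - c" using cd by (simp_all add: insert_commute)
    have l: "level (uminus ` V) (flip E) (Suc (Suc 0)) (- d) (- c)"
      "\<not> level (uminus ` V) (flip E) (Suc 0) (- d) (- c)"
      unfolding level_flip using lev2 cd(6) by simp_all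
    have deg': "card (nbhd (flip E) v) \<le> D" if "v \<in> uminus ` V" for v
      using deg[of "- v"] that by (auto simp: nbhd_flip card_image)
    show ?thesis using flipped.config_reducible[OF e l right left deg' D] reducible_flip by blast
  qed
qed

lemma outer_cycle_contract:
  assumes u: "u \<in> V" "N u = {x, y}" "x < u" "u < y"
  shows "outer_cycle (V - {u}) (contract E u x y)"
proof
  have V: "x \<in> V" "y \<in> V" using u(2) nb(1) edge_V by blast+
  obtain l where l: "l \<in> V" "l < u" "x \<le> l" "V \<inter> {l<..<u} = {}" "{u, l} \<in> E"
    using predecessor[OF u(1) V(1) u(3)] .
  obtain r where r: "r \<in> V" "u < r" "r \<le> y" "V \<inter> {u<..<r} = {}" "{u, r} \<in> E"
    using successor[OF u(1) V(2) u(4)] .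
  have "l \<in> {x, y}" "r \<in> {x, y}" using l(5) r(5) nb(1) u(2) by blast+
  then have lx: "l = x" and ry: "r = y" using l r u by auto
  have gap: "w = u" if "w \<in> V" "x < w" "w < y" for w
    using that l(4) r(4) lx ry by (cases w u rule: linorder_cases) auto
  show "simple_graph (V - {u}) (contract E u x y)"
    using simple V u by (auto simp: simple_graph_def contract_def)
  show "{a, b} \<in> contract E u x y"
    if h: "a \<in> V - {u}" "b \<in> V - {u}" "a < b" "(V - {u}) \<inter> {a<..<b} = {}" for a b
  proof (cases "a < u \<and> u < b")
    case True
    have "V \<inter> {a<..<u} = {}" "V \<inter> {u<..<b} = {}" using h(4) True by auto
    then have "a = x" "b = y"
      using adjacent_unique_left[OF l(4), of a] adjacent_unique[OF r(4), of b] l r h True lx ry by auto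
    then show ?thesis by (simp add: contract_def)
  next
    case False
    then have "V \<inter> {a<..<b} = {}" using h by (auto simp: disjoint_iff)
    then show ?thesis using consecutive[of a b] h by (auto simp: contract_def)
  qed
  have ne: "u \<noteq> Min V" "u \<noteq> Max V"
    using u V Min_Max(1)[of x] Min_Max(1)[of y] by auto
  have "Min (V - {u}) = Min V" "Max (V - {u}) = Max V"
    using ne fin Min_Max(1-3) by (auto intro!: Min_eqI Max_eqI)
  then show "{Min (V - {u}), Max (V - {u})} \<in> contract E u x y"
    using ends ne by (simp add: contract_def)
  show False if h: "{a, b} \<in> contract E u x y" "{c, d} \<in> contract E u x y" "a < c" "c < b" "b < d" for a b c d
  proof -
    have e: "{a, b} \<in> E \<and> u \<notin> {a, b} \<or> a = x \<and> b = y" "{c, d} \<in> E \<and> u \<notin> {c, d} \<or> c = x \<and> d = y"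
      using h u by (auto simp: contract_def doubleton_eq_iff)
    show False
    proof (cases "a = x \<and> b = y")
      case True
      then have "{c, d} \<in> E" "u \<noteq> c" using e h by auto
      then show False using gap[of c] edge_V[of c d] True h by auto
    next
      case ab: False
      show False
      proof (cases "c = x \<and> d = y")
        case True
        then show False using gap[of b] edge_V[of a b] e ab h by auto
      next
        case False
        then show False using noncrossing[of a b c d] e ab h by auto
      qed
    qed
  qed
qed

end

lemma contract_commute: "contract E u x y = contract E u y x"
  by (simp add: contract_def insert_commute)

lemma contract_degree:
  assumes G: "simple_graph V E" and u: "nbhd E u = {x, y}"
  shows "card (nbhd (contract E u x y) v) \<le> card (nbhd E v)"
proof -
  note nb = simple_graph_nbhd[OF G]
  have x: "u \<in> nbhd E x" and y: "u \<in> nbhd E y" using u nb(4) by blast+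
  have *: "card S \<le> card (nbhd E v)" if "u \<in> nbhd E v" "S \<subseteq> insert z (nbhd E v - {u})" for S z
  proof -
    have "card (nbhd E v) > 0" using that(1) nb(2)[of v] by (auto simp: card_gt_0_iff)
    then have "card (insert z (nbhd E v - {u})) \<le> card (nbhd E v)"
      using that(1) by (intro card_insert_le_m1) (simp_all add: card_Diff_singleton)
    moreover have "card S \<le> card (insert z (nbhd E v - {u}))"
      using that(2) nb(2)[of v] by (intro card_mono) simp_all
    ultimately show ?thesis by linarith
  qed
  consider "v = x" | "v = y" | "v \<noteq> x" "v \<noteq> y" by blast
  then show ?thesis
  proof cases
    case 1
    have "nbhd (contract E u x y) x \<subseteq> insert y (nbhd E x - {u})"
      by (auto simp: nbhd_def contract_def doubleton_eq_iff)
    then show ?thesis using * x 1 by blast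
  next
    case 2
    have "nbhd (contract E u x y) y \<subseteq> insert x (nbhd E y - {u})"
      by (auto simp: nbhd_def contract_def doubleton_eq_iff)
    then show ?thesis using * y 2 by blast
  next
    case 3
    have "nbhd (contract E u x y) v \<subseteq> nbhd E v"
      using 3 by (auto simp: nbhd_def contract_def doubleton_eq_iff)
    then show ?thesis using nb(2) by (rule card_mono[rotated])
  qed
qed

lemma frugal_choosable_mono:
  assumes "frugal_choosable k s V E" "s \<le> t"
  shows "frugal_choosable k t V E"
  unfolding frugal_choosable_def
proof (intro allI impI)
  fix L :: "'a \<Rightarrow> int set" assume L: "list_assignment t V L"
  have "\<exists>M. M \<subseteq> L v \<and> finite M \<and> card M = s" if "v \<in> V" for v
    using L that assms(2) obtain_subset_with_card_n[of s "L v"] unfolding list_assignment_def by metis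
  then obtain M where M: "\<And>v. v \<in> V \<Longrightarrow> M v \<subseteq> L v \<and> finite (M v) \<and> card (M v) = s" by metis
  then have "list_assignment s V M" by (simp add: list_assignment_def)
  then show "\<exists>c. frugal_colouring k V E c \<and> (\<forall>v\<in>V. c v \<in> L v)"
    using assms(1) M unfolding frugal_choosable_def by blast
qed

lemma outer_cycle_choosable:
  assumes "outer_cycle V E" "k \<ge> 1" "D \<ge> 7" "\<And>v. v \<in> V \<Longrightarrow> card (nbhd E v) \<le> D"
  shows "frugal_choosable k ((D - 2) div k + 3) V E"
  using assms
proof (induction "card V" arbitrary: V E rule: less_induct)
  case less
  interpret outer_cycle V E by fact
  show ?case
  proof (cases "card V \<le> 3")
    case True
    then show ?thesis using frugal_choosable_mono[OF frugal_choosable_card[OF simple less.prems(2)]] by simp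
  next
    case False
    then obtain u where "reducible D V E u" using ex_reducible less.prems by fastforce
    then obtain x y where r: "u \<in> V" "nbhd E u = {x, y}" "x < u \<and> u < y \<or> y < u \<and> u < x" "sparse_ends D E u x y"
      unfolding reducible_def by blast
    have oc: "outer_cycle (V - {u}) (contract E u x y)"
      using r(3)
    proof
      assume "y < u \<and> u < x"
      then show ?thesis using outer_cycle_contract[of u y x] r by (simp add: contract_commute insert_commute)
    qed (use outer_cycle_contract[of u x y] r in simp)
    have "card (V - {u}) < card V" using fin r(1) by (rule card_Diff1_less)
    moreover have "card (nbhd (contract E u x y) v) \<le> D" if "v \<in> V - {u}" for v
      using contract_degree[OF simple r(2), of v] less.prems(4)[of v] that by simp
    ultimately have "frugal_choosable k ((D - 2) div k + 3) (V - {u}) (contract E u x y)"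
      using less.hyps[OF _ oc less.prems(2,3)] by blast
    moreover have "x \<noteq> y" using r(3) by auto
    ultimately show ?thesis using extend_colouring[OF simple r(1,2) _ less.prems(2,3) r(4)] by blast
  qed
qed

section \<open>Hamiltonian cycles in outerplanar graphs\<close>

lemma set_eq_Union_ledges: "length xs \<ge> 2 \<Longrightarrow> set xs = \<Union> (ledges xs)"
proof (induction xs rule: ledges.induct)
  case (1 x y zs)
  then show ?case by (cases zs) auto
qed auto

lemma path_to_set:
  assumes "(u, v) \<in> {(x, y). {x, y} \<in> F}\<^sup>*" "v \<in> S"
  shows "\<exists>P z. z \<in> S \<and> set P \<inter> S = {} \<and> distinct P \<and> hd (P @ [z]) = u \<and> ledges (P @ [z]) \<subseteq> F"
  using assms
proof (induction rule: converse_rtrancl_induct)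
  case base
  then show ?case by (intro exI[of _ "[]"] exI[of _ v]) auto
next
  case (step y w)
  then obtain P z where P: "z \<in> S" "set P \<inter> S = {}" "distinct P" "hd (P @ [z]) = w" "ledges (P @ [z]) \<subseteq> F"
    by auto
  consider "y \<in> S" | "y \<notin> S" "y \<in> set P" | "y \<notin> S" "y \<notin> set P" by blast
  then show ?case
  proof cases
    case 1
    then show ?thesis by (intro exI[of _ "[]"] exI[of _ y]) auto
  next
    case 2
    then obtain P1 P2 where "P = P1 @ y # P2" by (meson split_list)
    then show ?thesis using P ledges_append[of P1 y "P2 @ [z]"]
      by (intro exI[of _ "y # P2"] exI[of _ z]) auto
  next
    case 3
    then show ?thesis using P step(1)
      by (intro exI[of _ "y # P"] exI[of _ z]) (cases P; auto)
  qed
qed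

text \<open>In contrast to \<open>outer_drawing.cycle\<close>, the first vertex is not repeated.\<close>

definition closed_cycle :: "'a set set \<Rightarrow> 'a list \<Rightarrow> bool" where
  "closed_cycle E zs \<longleftrightarrow> distinct zs \<and> length zs \<ge> 3 \<and> ledges (zs @ [hd zs]) \<subseteq> E"

lemma closed_cycle_rotate:
  assumes "closed_cycle E (L @ x # R)"
  shows "closed_cycle E (x # R @ L)"
proof (cases L)
  case (Cons l L')
  have "ledges (L @ x # R @ [l]) = ledges (L @ [x]) \<union> ledges (x # R @ [l])"
    by (rule ledges_append)
  moreover have "ledges (x # R @ L @ [x]) = ledges (x # R @ [l]) \<union> ledges (L @ [x])"
    using ledges_append[of "x # R" l "L' @ [x]"] Cons by simp
  ultimately show ?thesis using assms Cons by (auto simp: closed_cycle_def)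
qed (use assms in simp)

lemma connected_step:
  assumes "graph_connected W F" "v \<in> W" "W \<noteq> {v}"
  obtains w where "{v, w} \<in> F" "w \<noteq> v"
proof -
  obtain w' where w': "w' \<in> W" "w' \<noteq> v" using assms by blast
  then have "(v, w') \<in> {(x, y). {x, y} \<in> F}\<^sup>*" using assms by (auto simp: graph_connected_def)
  then have "\<exists>w. {v, w} \<in> F \<and> w \<noteq> v" using w'(2)
    by (induction rule: rtrancl_induct) auto
  then show ?thesis using that by blast
qed

context
  fixes V :: "'a set" and E :: "'a set set"
  assumes G: "simple_graph V E" and conn: "vertex_connected 2 V E"
begin

lemma card_V: "card V \<ge> 3" and finite_V: "finite V"
  using G conn by (auto simp: simple_graph_def vertex_connected_def)

lemma connected: "graph_connected V E"
  using conn unfolding vertex_connected_def by (auto dest!: spec[of _ "{}"])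

lemma connected_delete: "u \<in> V \<Longrightarrow> graph_connected (V - {u}) {e \<in> E. u \<notin> e}"
  using conn unfolding vertex_connected_def by (auto dest!: spec[of _ "{u}"])

lemma ex_closed_cycle: "\<exists>zs. closed_cycle E zs"
proof -
  have EV: "{a, b} \<in> E \<Longrightarrow> a \<in> V \<and> b \<in> V \<and> a \<noteq> b" for a b using G by (auto simp: simple_graph_def)
  have big: "\<not> V \<subseteq> {a, b}" for a b
    using card_V card_mono[of "{a, b}" V] by (auto simp: card_insert_if split: if_splits)
  obtain v where v: "v \<in> V" using card_V by fastforce
  obtain u where u: "{v, u} \<in> E" "u \<noteq> v" using connected_step[OF connected v] big[of v v] by auto
  then have uV: "u \<in> V" using EV by blast
  obtain w where w: "{v, w} \<in> E" "u \<notin> {v, w}"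
    using connected_step[OF connected_delete[OF uV], of v] v u big[of u v] by auto
  then have wV: "w \<in> V" "w \<noteq> v" using EV[of v w] by auto
  have "(u, w) \<in> {(x, y). {x, y} \<in> {e \<in> E. v \<notin> e}}\<^sup>*"
    using connected_delete[OF v] uV wV u unfolding graph_connected_def by blast
  then obtain P where P: "w \<notin> set P" "distinct P" "hd (P @ [w]) = u" "ledges (P @ [w]) \<subseteq> {e \<in> E. v \<notin> e}"
    using path_to_set[of u w "{e \<in> E. v \<notin> e}" "{w}"] by auto
  then obtain P' where P': "P = u # P'" using w by (cases P) auto
  have "v \<notin> set (P @ [w])" using set_eq_Union_ledges[of "P @ [w]"] P P' by auto
  moreover have "ledges (v # P @ [w, v]) = ledges (v # P @ [w]) \<union> {{w, v}}"
    using ledges_append[of "v # P" w "[v]"] by simp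
  ultimately have "closed_cycle E (v # P @ [w])" using P P' w u
    by (auto simp: closed_cycle_def insert_commute)
  then show ?thesis by blast
qed

lemma ex_hamiltonian_cycle:
  assumes no_theta: "\<And>x z A B P. A \<noteq> [] \<Longrightarrow> B \<noteq> [] \<Longrightarrow> P \<noteq> [] \<Longrightarrow> distinct (x # z # A @ B @ P) \<Longrightarrow>
    ledges (x # A @ [z]) \<subseteq> E \<Longrightarrow> ledges (x # B @ [z]) \<subseteq> E \<Longrightarrow> ledges (x # P @ [z]) \<subseteq> E \<Longrightarrow> False"
  shows "\<exists>zs. closed_cycle E zs \<and> set zs = V"
proof -
  have sub: "set zs \<subseteq> V" if "closed_cycle E zs" for zs
  proof -
    have "set (zs @ [hd zs]) = \<Union> (ledges (zs @ [hd zs]))"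
      using that by (intro set_eq_Union_ledges) (auto simp: closed_cycle_def)
    then have "set zs \<subseteq> \<Union> (ledges (zs @ [hd zs]))" by auto
    then show ?thesis using that G by (auto simp: closed_cycle_def simple_graph_def)
  qed
  have "length zs < Suc (card V)" if "closed_cycle E zs" for zs
    using card_mono[OF finite_V sub[OF that]] that distinct_card[of zs] by (simp add: closed_cycle_def)
  then obtain zs where zs: "closed_cycle E zs" "\<And>ys. closed_cycle E ys \<Longrightarrow> length ys \<le> length zs"
    using ex_closed_cycle ex_has_greatest_nat[of "closed_cycle E" _ length] by metis
  have "set zs = V"
  proof (rule ccontr)
    assume "set zs \<noteq> V"
    then obtain w where w: "w \<in> V" "w \<notin> set zs" using sub[OF zs(1)] by blast
    obtain v0 where v0: "v0 \<in> set zs" using zs(1) by (cases zs) (auto simp: closed_cycle_def)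
    have "(w, v0) \<in> {(x, y). {x, y} \<in> E}\<^sup>*"
      using connected w v0 sub[OF zs(1)] unfolding graph_connected_def by blast
    then obtain P0 x where P0: "x \<in> set zs" "set P0 \<inter> set zs = {}" "hd (P0 @ [x]) = w" "ledges (P0 @ [x]) \<subseteq> E"
      using path_to_set[of w v0 E "set zs"] v0 by auto
    then have "P0 \<noteq> []" using w by auto
    then obtain P1 y where "P0 = P1 @ [y]" by (metis rev_exhaust)
    then have y: "{y, x} \<in> E" "y \<notin> set zs" using P0 ledges_append[of P1 y "[x]"] by auto
    obtain L R where LR: "zs = L @ x # R" using P0(1) by (meson split_list)
    have cyc: "closed_cycle E (x # R @ L)" using closed_cycle_rotate[of E L x R] zs(1) LR by simp
    have d: "distinct (x # R @ L)" using cyc by (simp add: closed_cycle_def)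
    obtain v1 where v1: "v1 \<in> set (R @ L)" using cyc by (cases "R @ L") (auto simp: closed_cycle_def)
    have xV: "x \<in> V" "y \<in> V" "v1 \<in> V" using y(1) G sub[OF cyc] v1 by (auto simp: simple_graph_def)
    have "(y, v1) \<in> {(a, b). {a, b} \<in> {e \<in> E. x \<notin> e}}\<^sup>*"
    proof -
      have "y \<noteq> x" "v1 \<noteq> x" using y(2) P0(1) d v1 by auto
      then show ?thesis using connected_delete[OF xV(1)] xV unfolding graph_connected_def by blast
    qed
    note yv1 = this
    obtain Q z where Q: "z \<in> set (R @ L)" "set Q \<inter> set (R @ L) = {}" "distinct Q" "hd (Q @ [z]) = y"
      "ledges (Q @ [z]) \<subseteq> {e \<in> E. x \<notin> e}"
      using path_to_set[OF yv1 v1] by blast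
    have zset: "set zs = insert x (set (R @ L))" using LR by auto
    obtain Q' where Q': "Q = y # Q'" using Q(1,4) y(2) zset by (cases Q) auto
    have "x \<notin> set (Q @ [z])" using set_eq_Union_ledges[of "Q @ [z]"] Q Q' by auto
    then have xQ: "x \<notin> set Q" "x \<noteq> z" by auto
    have eQ: "ledges (x # Q @ [z]) \<subseteq> E" using Q Q' y by (auto simp: insert_commute)
    obtain A B where AB: "R @ L = A @ z # B" using Q(1) by (meson split_list)
    have dd: "distinct (x # z # A @ B @ Q)" using d AB Q xQ by auto
    have len: "length zs = 2 + length A + length B"
      using arg_cong[OF AB, of length] LR by simp
    have eA: "ledges (x # A @ [z]) \<subseteq> E" and eB: "ledges (z # B @ [x]) \<subseteq> E"
      using cyc AB ledges_append[of "x # A" z "B @ [x]"] by (auto simp: closed_cycle_def)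
    have eB': "ledges (x # rev B @ [z]) \<subseteq> E" using eB ledges_rev[of "z # B @ [x]"] by simp
    have eQ': "ledges (z # rev Q @ [x]) \<subseteq> E" using eQ ledges_rev[of "x # Q @ [z]"] by simp
    have longer: False if "ledges (x # M @ [z]) \<subseteq> E" "ledges (z # N @ [x]) \<subseteq> E" "distinct (x # M @ z # N)"
      "length M + length N > length A + length B" for M N
    proof -
      have "closed_cycle E (x # M @ z # N)"
        using that len zs(1) ledges_append[of "x # M" z "N @ [x]"] by (auto simp: closed_cycle_def)
      then show False using zs(2)[of "x # M @ z # N"] len that(4) by simp
    qed
    show False
    proof (cases "A = [] \<or> B = []")
      case True
      then show False
      proof
        assume "A = []"
        then show False using longer[OF eQ eB] dd Q' by (auto simp: Int_commute)
      next
        assume "B = []"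
        then show False using longer[OF eA eQ'] dd Q' by (auto simp: Int_commute)
      qed
    next
      case False
      then show False using no_theta[of A "rev B" Q x z] dd eA eB' eQ Q' by auto
    qed
  qed
  then show ?thesis using zs(1) by blast
qed

end

lemma nbhd_relabel:
  assumes G: "simple_graph V E" and inj: "inj_on \<phi> V" and v: "v \<in> V"
  shows "nbhd ((`) \<phi> ` E) (\<phi> v) = \<phi> ` nbhd E v"
proof
  show "nbhd ((`) \<phi> ` E) (\<phi> v) \<subseteq> \<phi> ` nbhd E v"
  proof
    fix w assume w: "w \<in> nbhd ((`) \<phi> ` E) (\<phi> v)"
    then obtain e where e: "e \<in> E" "{w, \<phi> v} = \<phi> ` e" by (auto simp: nbhd_def)
    then obtain x y where xy: "e = {x, y}" "x \<in> V" "y \<in> V" "x \<noteq> y"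
      using G by (auto simp: simple_graph_def card_2_iff)
    have "{w, \<phi> v} = {\<phi> x, \<phi> y}" using e(2) xy(1) by simp
    then consider "\<phi> v = \<phi> y" "w = \<phi> x" | "\<phi> v = \<phi> x" "w = \<phi> y" by (auto simp: doubleton_eq_iff)
    then show "w \<in> \<phi> ` nbhd E v"
    proof cases
      case 1
      then have "v = y" using inj_onD[OF inj] v xy(3) by blast
      then show ?thesis using 1 e(1) xy by (auto simp: nbhd_def)
    next
      case 2
      then have "v = x" using inj_onD[OF inj] v xy(2) by blast
      then show ?thesis using 2 e(1) xy by (auto simp: nbhd_def insert_commute)
    qed
  qed
  show "\<phi> ` nbhd E v \<subseteq> nbhd ((`) \<phi> ` E) (\<phi> v)"
  proof
    fix w assume "w \<in> \<phi> ` nbhd E v"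
    then obtain u where u: "w = \<phi> u" "{u, v} \<in> E" "u \<noteq> v" by (auto simp: nbhd_def)
    then have "u \<in> V" using G by (auto simp: simple_graph_def)
    then have "\<phi> u \<noteq> \<phi> v" using inj_onD[OF inj] v u(3) by blast
    moreover have "\<phi> ` {u, v} \<in> (`) \<phi> ` E" using u(2) by (rule imageI)
    ultimately show "w \<in> nbhd ((`) \<phi> ` E) (\<phi> v)" using u(1) by (simp add: nbhd_def)
  qed
qed

lemma frugal_choosable_relabel:
  assumes G: "simple_graph V E" and inj: "inj_on \<phi> V"
    and ch: "frugal_choosable k t (\<phi> ` V) ((`) \<phi> ` E)"
  shows "frugal_choosable k t V E"
  unfolding frugal_choosable_def
proof (intro allI impI)
  fix L :: "'a \<Rightarrow> int set" assume L: "list_assignment t V L"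
  have "list_assignment t (\<phi> ` V) (L \<circ> inv_into V \<phi>)"
    using L inj by (auto simp: list_assignment_def)
  then obtain c where c: "frugal_colouring k (\<phi> ` V) ((`) \<phi> ` E) c" "\<forall>w\<in>\<phi> ` V. c w \<in> (L \<circ> inv_into V \<phi>) w"
    using ch unfolding frugal_choosable_def by blast
  have "frugal_colouring k V E (c \<circ> \<phi>)"
    unfolding frugal_colouring_def
  proof (intro conjI allI impI ballI)
    fix u v assume uv: "{u, v} \<in> E \<and> u \<noteq> v"
    then have "u \<in> V" "v \<in> V" using G by (auto simp: simple_graph_def)
    moreover have "u \<in> nbhd E v" using uv by (simp add: nbhd_def)
    ultimately have "\<phi> u \<in> nbhd ((`) \<phi> ` E) (\<phi> v)" using nbhd_relabel[OF G inj] by blast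
    then show "(c \<circ> \<phi>) u \<noteq> (c \<circ> \<phi>) v" using c(1) by (auto simp: frugal_colouring_def nbhd_def)
  next
    fix v i assume v: "v \<in> V"
    have "inj_on \<phi> {u \<in> nbhd E v. (c \<circ> \<phi>) u = i}"
      using simple_graph_nbhd(1)[OF G, of v] by (intro inj_on_subset[OF inj]) auto
    then have "card {u \<in> nbhd E v. (c \<circ> \<phi>) u = i} = card (\<phi> ` {u \<in> nbhd E v. (c \<circ> \<phi>) u = i})"
      by (simp add: card_image)
    also have "\<phi> ` {u \<in> nbhd E v. (c \<circ> \<phi>) u = i} = {w \<in> nbhd ((`) \<phi> ` E) (\<phi> v). c w = i}"
      unfolding nbhd_relabel[OF G inj v] by auto
    also have "card \<dots> \<le> k" using c(1) v by (auto simp: frugal_colouring_def)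
    finally show "card {u \<in> nbhd E v. (c \<circ> \<phi>) u = i} \<le> k" .
  qed
  moreover have "(c \<circ> \<phi>) v \<in> L v" if "v \<in> V" for v
    using c(2) that inj by auto
  ultimately show "\<exists>c. frugal_colouring k V E c \<and> (\<forall>v\<in>V. c v \<in> L v)" by blast
qed

lemma ledges_nth: "Suc i < length xs \<Longrightarrow> {xs ! i, xs ! Suc i} \<in> ledges xs"
proof (induction xs arbitrary: i rule: ledges.induct)
  case (1 x y zs)
  then show ?case by (cases i) auto
qed auto

lemma drop_split:
  assumes "i < j" "j < length xs"
  obtains A where "drop (Suc i) xs = A @ xs ! j # drop (Suc j) xs"
  using id_take_nth_drop[of "j - Suc i" "drop (Suc i) xs"] assms that
  by (auto simp: less_diff_conv)

lemma outer_cycle_relabel: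
  assumes G: "simple_graph V E" and zs: "closed_cycle E zs" "set zs = V"
    and nc: "\<And>a A c B b C d F. distinct (a # A @ c # B @ b # C @ d # F) \<Longrightarrow>
      ledges (a # A @ [c]) \<subseteq> E \<Longrightarrow> ledges (c # B @ [b]) \<subseteq> E \<Longrightarrow> ledges (b # C @ [d]) \<subseteq> E \<Longrightarrow>
      ledges (d # F @ [a]) \<subseteq> E \<Longrightarrow> {a, b} \<in> E \<Longrightarrow> {c, d} \<in> E \<Longrightarrow> False"
  obtains \<phi> :: "'a \<Rightarrow> int" where "inj_on \<phi> V" "outer_cycle (\<phi> ` V) ((`) \<phi> ` E)"
proof -
  let ?n = "length zs"
  have n: "distinct zs" "?n \<ge> 3" "ledges (zs @ [hd zs]) \<subseteq> E" using zs by (auto simp: closed_cycle_def)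
  define \<phi> where "\<phi> v = int (the_inv_into {..<?n} (nth zs) v)" for v
  have bij: "bij_betw (nth zs) {..<?n} V" using bij_betw_nth[OF n(1)] zs(2) by simp
  have \<phi>: "\<phi> (zs ! i) = int i" if "i < ?n" for i
    using the_inv_into_f_f[of "nth zs" "{..<?n}" i] bij that by (simp add: \<phi>_def bij_betw_def)
  have ex: "\<exists>i<?n. v = zs ! i" if "v \<in> V" for v using that zs(2) by (auto simp: in_set_conv_nth)
  have inj: "inj_on \<phi> V"
  proof (rule inj_onI)
    fix v w assume "v \<in> V" "w \<in> V" "\<phi> v = \<phi> w"
    then show "v = w" using ex[of v] ex[of w] \<phi> by auto
  qed
  have V': "\<phi> ` V = int ` {..<?n}"
  proof -
    have "\<phi> ` V = \<phi> ` nth zs ` {..<?n}" using bij_betw_imp_surj_on[OF bij] by simp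
    also have "\<dots> = int ` {..<?n}" unfolding image_image using \<phi> by (intro image_cong) auto
    finally show ?thesis .
  qed
  have edge: "{zs ! i, zs ! j} \<in> E" if e: "{int i, int j} \<in> (`) \<phi> ` E" and ij: "i < ?n" "j < ?n" for i j
  proof -
    obtain e' where e': "e' \<in> E" "\<phi> ` {zs ! i, zs ! j} = \<phi> ` e'" using e ij \<phi> by auto
    moreover have "e' \<subseteq> V" "{zs ! i, zs ! j} \<subseteq> V" using e'(1) G ij zs(2) by (auto simp: simple_graph_def)
    ultimately show ?thesis using inj_on_image_eq_iff[OF inj] by metis
  qed
  have edge': "{int i, int j} \<in> (`) \<phi> ` E" if "{zs ! i, zs ! j} \<in> E" "i < ?n" "j < ?n" for i j
  proof -
    have "\<phi> ` {zs ! i, zs ! j} \<in> (`) \<phi> ` E" using that(1) by (rule imageI)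
    then show ?thesis using that \<phi> by simp
  qed
  have G': "simple_graph (\<phi> ` V) ((`) \<phi> ` E)"
  proof -
    have "\<phi> ` e \<subseteq> \<phi> ` V \<and> card (\<phi> ` e) = 2" if "e \<in> E" for e
    proof -
      have "e \<subseteq> V" "card e = 2" using that G by (auto simp: simple_graph_def)
      then show ?thesis using card_image[OF inj_on_subset[OF inj]] by auto
    qed
    then show ?thesis using G by (auto simp: simple_graph_def)
  qed
  have "outer_cycle (\<phi> ` V) ((`) \<phi> ` E)"
  proof
    show "simple_graph (\<phi> ` V) ((`) \<phi> ` E)" by (rule G')
    show "{a, b} \<in> (`) \<phi> ` E"
      if h: "a \<in> \<phi> ` V" "b \<in> \<phi> ` V" "a < b" "\<phi> ` V \<inter> {a<..<b} = {}" for a b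
    proof -
      obtain i j where ij: "a = int i" "b = int j" "i < ?n" "j < ?n" using h(1,2) unfolding V' by auto
      have "j = Suc i"
      proof (rule ccontr)
        assume "j \<noteq> Suc i"
        then have "Suc i < j" using ij h(3) by auto
        then have "Suc i \<in> {..<?n}" "int (Suc i) \<in> {a<..<b}" using ij by auto
        then have "int (Suc i) \<in> \<phi> ` V \<inter> {a<..<b}" unfolding V' by blast
        then show False using h(4) by blast
      qed
      moreover have "{zs ! i, zs ! Suc i} \<in> E" if "Suc i < ?n"
        using ledges_nth[of i "zs @ [hd zs]"] n(3) that by (auto simp: nth_append)
      ultimately show ?thesis using edge'[of i j] ij by simp
    qed
    have "Min (\<phi> ` V) = int 0" "Max (\<phi> ` V) = int (?n - 1)"
    proof -
      have "0 \<in> {..<?n}" "?n - 1 \<in> {..<?n}" using n(2) by auto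
      then have "int 0 \<in> int ` {..<?n}" "int (?n - 1) \<in> int ` {..<?n}" by blast+
      then show "Min (\<phi> ` V) = int 0" "Max (\<phi> ` V) = int (?n - 1)"
        unfolding V' by (auto intro!: Min_eqI Max_eqI)
    qed
    moreover have "{zs ! (?n - 1), zs ! 0} \<in> E"
    proof -
      have "zs \<noteq> []" "Suc (?n - 1) = ?n" using n(2) by auto
      then have "(zs @ [hd zs]) ! (?n - 1) = zs ! (?n - 1)" "(zs @ [hd zs]) ! Suc (?n - 1) = zs ! 0"
        "Suc (?n - 1) < length (zs @ [hd zs])"
        by (simp_all add: nth_append hd_conv_nth)
      then show ?thesis using ledges_nth[of "?n - 1" "zs @ [hd zs]"] n(3) by auto
    qed
    ultimately show "{Min (\<phi> ` V), Max (\<phi> ` V)} \<in> (`) \<phi> ` E"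
      using edge'[of "?n - 1" 0] n(2) by (cases "zs = []") (simp_all add: insert_commute)
    show False if h: "{a, b} \<in> (`) \<phi> ` E" "{c, d} \<in> (`) \<phi> ` E" "a < c" "c < b" "b < d" for a b c d
    proof -
      have "{a, b} \<subseteq> \<phi> ` V" "{c, d} \<subseteq> \<phi> ` V"
        using h(1,2) G' unfolding simple_graph_def by blast+
      then obtain i j k l where e: "a = int i" "c = int j" "b = int k" "d = int l"
        and lt: "i < ?n" "j < ?n" "k < ?n" "l < ?n"
        unfolding V' by auto
      have o: "i < j" "j < k" "k < l" using h e by auto
      obtain A where A: "drop (Suc i) zs = A @ zs ! j # drop (Suc j) zs" using drop_split[OF o(1) lt(2)] .
      obtain B where B: "drop (Suc j) zs = B @ zs ! k # drop (Suc k) zs" using drop_split[OF o(2) lt(3)] .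
      obtain C where C: "drop (Suc k) zs = C @ zs ! l # drop (Suc l) zs" using drop_split[OF o(3) lt(4)] .
      define F where "F = drop (Suc l) zs @ take i zs"
      let ?a = "zs ! i" and ?c = "zs ! j" and ?b = "zs ! k" and ?d = "zs ! l"
      have "zs = take i zs @ ?a # A @ ?c # B @ ?b # C @ ?d # drop (Suc l) zs"
        using id_take_nth_drop[OF lt(1)] A B C by simp
      then have cyc: "closed_cycle E (?a # A @ ?c # B @ ?b # C @ ?d # F)"
        using closed_cycle_rotate[of E "take i zs" ?a "A @ ?c # B @ ?b # C @ ?d # drop (Suc l) zs"] zs(1)
        by (simp add: F_def)
      then have d: "distinct (?a # A @ ?c # B @ ?b # C @ ?d # F)" by (simp add: closed_cycle_def)
      have "ledges (?a # A @ ?c # B @ ?b # C @ ?d # F @ [?a]) \<subseteq> E" using cyc by (simp add: closed_cycle_def)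
      moreover have "ledges (?a # A @ ?c # B @ ?b # C @ ?d # F @ [?a]) =
        ledges (?a # A @ [?c]) \<union> (ledges (?c # B @ [?b]) \<union> (ledges (?b # C @ [?d]) \<union> ledges (?d # F @ [?a])))"
        using ledges_append[of "?a # A" ?c "B @ ?b # C @ ?d # F @ [?a]"]
          ledges_append[of "?c # B" ?b "C @ ?d # F @ [?a]"] ledges_append[of "?b # C" ?d "F @ [?a]"]
        by simp
      ultimately have "ledges (?a # A @ [?c]) \<subseteq> E" "ledges (?c # B @ [?b]) \<subseteq> E"
        "ledges (?b # C @ [?d]) \<subseteq> E" "ledges (?d # F @ [?a]) \<subseteq> E" by blast+
      moreover have "{?a, ?b} \<in> E" "{?c, ?d} \<in> E" using edge h(1,2) e lt by blast+
      ultimately show False using nc[OF d] by blast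
    qed
  qed
  then show thesis using that inj by blast
qed

theorem theorem13:
  fixes k :: nat and V :: "'a set" and E :: "'a set set"
  assumes "k \<ge> 1"
    and "simple_graph V E"
    and "vertex_connected 2 V E"
    and "outerplanar V E"
    and "max_degree V E \<ge> 7"
  shows "int (frugal_choice_number k V E) \<le> \<lfloor>(real (max_degree V E) - 2) / real k\<rfloor> + 3"
proof -
  let ?D = "max_degree V E"
  let ?t = "(?D - 2) div k + 3"
  obtain pos \<gamma> where "outer_drawing V E pos \<gamma>"
    using assms(2,4) unfolding outerplanar_def outer_drawing_def by blast
  then interpret outer_drawing V E pos \<gamma> .
  have "\<exists>zs. closed_cycle E zs \<and> set zs = V"
    by (rule ex_hamiltonian_cycle[OF assms(2,3)]) (rule theta_impossible; assumption)
  then obtain zs where zs: "closed_cycle E zs" "set zs = V" by blast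
  obtain \<phi> :: "'a \<Rightarrow> int" where \<phi>: "inj_on \<phi> V" "outer_cycle (\<phi> ` V) ((`) \<phi> ` E)"
  proof (rule outer_cycle_relabel[OF assms(2) zs])
    show False
      if "distinct (a # A @ c # B @ b # C @ d # F)" "ledges (a # A @ [c]) \<subseteq> E" "ledges (c # B @ [b]) \<subseteq> E"
        "ledges (b # C @ [d]) \<subseteq> E" "ledges (d # F @ [a]) \<subseteq> E" "{a, b} \<in> E" "{c, d} \<in> E" for a A c B b C d F
      using crossing_impossible[OF that] .
  qed
  have "card (nbhd ((`) \<phi> ` E) w) \<le> ?D" if w: "w \<in> \<phi> ` V" for w
  proof -
    obtain v where v: "v \<in> V" "w = \<phi> v" using w by blast
    have "card (nbhd ((`) \<phi> ` E) w) \<le> card (nbhd E v)"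
      unfolding v(2) nbhd_relabel[OF assms(2) \<phi>(1) v(1)]
      using simple_graph_nbhd(2)[OF assms(2)] by (rule card_image_le)
    also have "\<dots> \<le> ?D"
      unfolding max_degree_def using v(1) assms(2) by (intro Max_ge) (auto simp: simple_graph_def)
    finally show ?thesis .
  qed
  then have "frugal_choosable k ?t (\<phi> ` V) ((`) \<phi> ` E)"
    by (rule outer_cycle_choosable[OF \<phi>(2) assms(1,5)])
  then have "frugal_choosable k ?t V E" by (rule frugal_choosable_relabel[OF assms(2) \<phi>(1)])
  then have "frugal_choice_number k V E \<le> ?t" unfolding frugal_choice_number_def by (rule Least_le)
  moreover have "\<lfloor>(real ?D - 2) / real k\<rfloor> = int ((?D - 2) div k)"
    using assms(5) floor_divide_of_nat_eq[of "?D - 2" k, where 'a = real] by (simp add: of_nat_diff)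
  ultimately show ?thesis by linarith
qed

end
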